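(* Let $w:\mathbb{R}\to[0,\infty)$ be a symmetric decreasing function with $w\in L^1(\mathbb{R})\cap L^\infty(\mathbb{R})$ and $\|w\|_{L^1(\mathbb{R})}=\|w\|_{L^\infty(\mathbb{R})}=1$. Let $C_{opt}=C_{opt}(w)$ be the smallest constant such that $$\int_{\mathbb{R}^2} f(x)f(y)\,w(x-y)\,dx\,dy\le C_{opt}\,\|f\|_1\|f\|_2\qquad\text{for all } f\in L^1(\mathbb{R})\cap L^2(\mathbb{R}).$$ Then there exists a function $f^\star\in L^1(\mathbb{R})\cap L^2(\mathbb{R})$ (depending on $w$), not almost everywhere zero, which is bounded, symmetrically decreasing and compactly supported, such that $$\int_{\mathbb{R}^2} f^\star(x)f^\star(y)\,w(x-y)\,dx\,dy= C_{opt}\,\|f^\star\|_1\|f^\star\|_2 .$$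
   Context: Functions $f$ are real-valued and $\|\cdot\|_p$ denotes the $L^p(\mathbb{R})$ norm with respect to Lebesgue measure. A function $g$ on $\mathbb{R}$ is symmetric decreasing (symmetrically decreasing) if it is nonnegative, even, and non-increasing as a function of $|x|$. *)

theory Defs
  imports "HOL-Analysis.Analysis" "HOL-Probability.Essential_Supremum"
begin

definition in_Lp :: "real \<Rightarrow> (real \<Rightarrow> real) \<Rightarrow> bool" where
  "in_Lp p f \<longleftrightarrow>
     f \<in> borel_measurable lebesgue \<and> integrable lebesgue (\<lambda>x. \<bar>f x\<bar> powr p)"

definition Lp_norm :: "real \<Rightarrow> (real \<Rightarrow> real) \<Rightarrow> real" where
  "Lp_norm p f = (\<integral>x. \<bar>f x\<bar> powr p \<partial>lebesgue) powr (1 / p)"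

text \<open>The essential supremum is formed in the extended reals, where it always exists.\<close>

definition in_Linf :: "(real \<Rightarrow> real) \<Rightarrow> bool" where
  "in_Linf f \<longleftrightarrow>
     f \<in> borel_measurable lebesgue \<and> esssup lebesgue (\<lambda>x. ereal \<bar>f x\<bar>) < \<infinity>"

definition Linf_norm :: "(real \<Rightarrow> real) \<Rightarrow> real" where
  "Linf_norm f = real_of_ereal (esssup lebesgue (\<lambda>x. ereal \<bar>f x\<bar>))"

definition symmetric_decreasing :: "(real \<Rightarrow> real) \<Rightarrow> bool" where
  "symmetric_decreasing g \<longleftrightarrow>
     (\<forall>x. 0 \<le> g x) \<and> (\<forall>x. g (- x) = g x) \<and> (\<forall>x y. \<bar>x\<bar> \<le> \<bar>y\<bar> \<longrightarrow> g y \<le> g x)"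

definition compactly_supported :: "(real \<Rightarrow> real) \<Rightarrow> bool" where
  "compactly_supported f \<longleftrightarrow> compact (closure {x. f x \<noteq> 0})"

text \<open>
  For \<open>f\<close> in \<open>L\<^sup>1\<close> and bounded measurable \<open>w\<close> the integrand is integrable on the plane,
  so the default value of the Bochner integral plays no role below.
\<close>

definition conv_form :: "(real \<Rightarrow> real) \<Rightarrow> (real \<Rightarrow> real) \<Rightarrow> real" where
  "conv_form w f = (\<integral>(x, y). f x * f y * w (x - y) \<partial>(lebesgue :: (real \<times> real) measure))"

definition C_opt :: "(real \<Rightarrow> real) \<Rightarrow> real" where
  "C_opt w = (LEAST C. \<forall>f. in_Lp 1 f \<and> in_Lp 2 f \<longrightarrow>
                conv_form w f \<le> C * Lp_norm 1 f * Lp_norm 2 f)"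

end

theory Submission
  imports Defs "HOL-Probability.Helly_Selection" "HOL-Real_Asymp.Real_Asymp"
begin

text \<open>
  Write \<open>Q f\<close> for the quadratic form, \<open>m\<close> and \<open>n\<close> for the \<open>L\<^sup>1\<close> and \<open>L\<^sup>2\<close> norms of \<open>f\<close>. The bounds
  \<open>Q f \<le> w 0 * m\<^sup>2\<close> and \<open>Q f \<le> n\<^sup>2\<close> show that the best constant \<open>C\<close> is finite, and that near-optimal
  \<open>f\<close> with \<open>n = 1\<close> have \<open>m\<close> bounded and bounded away from \<open>0\<close>. By density there is a maximizing
  sequence of step functions on finer and finer grids. On a grid, finitely many two-point
  rearrangements (reflections at \<open>0\<close> and \<open>1/2\<close>) bring the values into the order
  \<open>b\<^sub>0 \<ge> b\<^sub>1 \<ge> b\<^sub>-\<^sub>1 \<ge> b\<^sub>2 \<ge> \<dots>\<close> without decreasing \<open>Q\<close>, so that Helly's selection theorem applies and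
  yields an even limit that decreases in \<open>\<bar>x\<bar>\<close>; dominated convergence and Fatou's lemma make it a maximizer.

  If \<open>f\<close> is a maximizer and \<open>f\<^sub>1 \<le> f\<close> agrees with \<open>f\<close> wherever \<open>f * w > B\<close>, then
  \<open>Q f - Q f\<^sub>1 \<le> 2 B \<integral> (f - f\<^sub>1)\<close>. Since \<open>f * w\<close> vanishes at infinity, comparing this with
  \<open>Q f\<^sub>1 \<le> C m\<^sub>1 n\<^sub>1\<close> for a cutoff in the domain shows that the support is compact, and for a
  cutoff in the range that \<open>f\<close> is bounded.
\<close>

section \<open>The discrete Riesz rearrangement inequality\<close>

text \<open>Treats the reflections of the integers at 0 and at 1/2 together. \<open>H\<close> is the
  half-line that is to receive the larger values. By \<open>same_side\<close> and
  \<open>other_side\<close>, reflecting a point brings it no closer to points of its own side and no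
  farther from those of the other side. By \<open>cover\<close>, a fixed point lies in
  \<open>H\<close>.\<close>

locale reflection =
  fixes \<sigma> :: "int \<Rightarrow> int" and H :: "int \<Rightarrow> bool"
  assumes invol [simp]: "\<sigma> (\<sigma> i) = i"
    and isom: "\<bar>\<sigma> i - \<sigma> j\<bar> = \<bar>i - j\<bar>"
    and same_side: "H i = H j \<Longrightarrow> \<bar>i - j\<bar> \<le> \<bar>i - \<sigma> j\<bar>"
    and other_side: "H i \<noteq> H j \<Longrightarrow> \<bar>i - \<sigma> j\<bar> \<le> \<bar>i - j\<bar>"
    and cover: "H i \<or> H (\<sigma> i)"
    and fixed: "H i \<Longrightarrow> H (\<sigma> i) \<Longrightarrow> \<sigma> i = i"
begin

text \<open>Known as polarization or two-point symmetrization, the elementary move towards the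
  symmetric decreasing rearrangement.\<close>

definition polarize :: "(int \<Rightarrow> real) \<Rightarrow> int \<Rightarrow> real" where
  "polarize b i = (if H i then max (b i) (b (\<sigma> i)) else min (b i) (b (\<sigma> i)))"

text \<open>The invariance statements below reduce to this dichotomy: a swap inside an orbit changes
  no symmetric function of its two values.\<close>

lemma polarize_cases:
  "polarize b i = b i \<and> polarize b (\<sigma> i) = b (\<sigma> i) \<or>
   polarize b i = b (\<sigma> i) \<and> polarize b (\<sigma> i) = b i"
  using cover[of i] fixed[of i] by (cases "H i"; cases "H (\<sigma> i)") (auto simp: polarize_def)

lemma polarize_order: "H i \<Longrightarrow> polarize b (\<sigma> i) \<le> polarize b i"
  using fixed[of i] by (cases "H (\<sigma> i)") (auto simp: polarize_def)

lemma polarize_pair_sum: "polarize b i + polarize b (\<sigma> i) = b i + b (\<sigma> i)"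
  using polarize_cases[of b i] by auto

lemma sum_reflect:
  assumes "\<sigma> ` J \<subseteq> J"
  shows "(\<Sum>i\<in>J. f (\<sigma> i)) = (\<Sum>i\<in>J. f i :: real)"
proof -
  have "bij_betw \<sigma> J J"
    by (rule bij_betw_byWitness[where f' = \<sigma>]) (use assms in auto)
  then show ?thesis by (rule sum.reindex_bij_betw)
qed

lemma sum_pair:
  assumes "\<sigma> ` J \<subseteq> J"
  shows "2 * (\<Sum>i\<in>J. f i) = (\<Sum>i\<in>J. f i + f (\<sigma> i) :: real)"
  using sum_reflect[OF assms, of f] by (simp add: sum.distrib)

lemma sum_polarize:
  assumes "\<sigma> ` J \<subseteq> J"
  shows "(\<Sum>i\<in>J. g (polarize b i)) = (\<Sum>i\<in>J. g (b i) :: real)"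
proof -
  have "g (polarize b i) + g (polarize b (\<sigma> i)) = g (b i) + g (b (\<sigma> i))" for i
    using polarize_cases[of b i] by auto
  then show ?thesis
    using sum_pair[OF assms, of "\<lambda>i. g (polarize b i)"] sum_pair[OF assms, of "\<lambda>i. g (b i)"]
    by simp
qed

text \<open>The rearrangement inequality for two terms, applied on each orbit: a swap happens only
  when the smaller value sits in \<open>H\<close>, and then it moves the larger value to the larger
  weight. The orbit of \<open>j\<close> makes the gain strict.\<close>

lemma weighted_sum_polarize:
  assumes "\<sigma> ` J \<subseteq> J" "finite J" and \<rho>: "\<And>i. H i \<Longrightarrow> \<sigma> i \<noteq> i \<Longrightarrow> \<rho> (\<sigma> i) < (\<rho> i :: real)"
    and j: "j \<in> J" "polarize b j \<noteq> b j"
  shows "(\<Sum>i\<in>J. \<rho> i * b i) < (\<Sum>i\<in>J. \<rho> i * polarize b i)"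
proof -
  have *: "\<rho> i * b i + \<rho> (\<sigma> i) * b (\<sigma> i) \<le> \<rho> i * polarize b i + \<rho> (\<sigma> i) * polarize b (\<sigma> i) \<and>
     (polarize b i \<noteq> b i \<longrightarrow>
      \<rho> i * b i + \<rho> (\<sigma> i) * b (\<sigma> i) < \<rho> i * polarize b i + \<rho> (\<sigma> i) * polarize b (\<sigma> i))" for i
  proof (cases "polarize b i = b i")
    case True then show ?thesis using polarize_cases[of b i] by auto
  next
    case False
    then have sw: "polarize b i = b (\<sigma> i)" "polarize b (\<sigma> i) = b i" and ne: "b i \<noteq> b (\<sigma> i)"
      using polarize_cases[of b i] by auto
    \<comment> \<open>This product is exactly the gain of the weighted orbit sum under the
      swap.\<close>
    have "(\<rho> i - \<rho> (\<sigma> i)) * (b (\<sigma> i) - b i) > 0"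
    proof (cases "H i")
      case True
      then have "\<rho> (\<sigma> i) < \<rho> i" using \<rho>[of i] ne by metis
      then show ?thesis using polarize_order[of i b] True sw ne
        by (intro mult_pos_pos) auto
    next
      case False
      then have "H (\<sigma> i)" using cover by blast
      then have "\<rho> i < \<rho> (\<sigma> i)" using \<rho>[of "\<sigma> i"] ne by (metis invol)
      then show ?thesis using polarize_order[of "\<sigma> i" b] \<open>H (\<sigma> i)\<close> sw ne
        by (intro mult_neg_neg) auto
    qed
    then show ?thesis using sw by (simp add: algebra_simps)
  qed
  have "(\<Sum>i\<in>J. \<rho> i * b i + \<rho> (\<sigma> i) * b (\<sigma> i))
      < (\<Sum>i\<in>J. \<rho> i * polarize b i + \<rho> (\<sigma> i) * polarize b (\<sigma> i))"
    by (rule sum_strict_mono_ex1) (use assms(2) j * in auto)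
  then show ?thesis
    using sum_pair[OF assms(1), of "\<lambda>i. \<rho> i * polarize b i"]
      sum_pair[OF assms(1), of "\<lambda>i. \<rho> i * b i"] by simp
qed

text \<open>Two orbits contribute a coefficient \<open>p\<close> at distance \<open>i - j\<close>
  and a coefficient \<open>q\<close> at distance \<open>i - \<sigma> j\<close>. Polarization
  preserves \<open>p + q\<close> and either keeps or exchanges the two, and afterwards the larger
  coefficient stands at the smaller distance, where \<open>W\<close> is larger.\<close>

lemma four_point:
  assumes W: "\<And>i j. \<bar>i\<bar> \<le> \<bar>j\<bar> \<Longrightarrow> W j \<le> (W i :: real)"
  shows "(b i * b j + b (\<sigma> i) * b (\<sigma> j)) * W (i - j) + (b i * b (\<sigma> j) + b (\<sigma> i) * b j) * W (i - \<sigma> j)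
    \<le> (polarize b i * polarize b j + polarize b (\<sigma> i) * polarize b (\<sigma> j)) * W (i - j)
      + (polarize b i * polarize b (\<sigma> j) + polarize b (\<sigma> i) * polarize b j) * W (i - \<sigma> j)"
proof -
  define p where "p = b i * b j + b (\<sigma> i) * b (\<sigma> j)"
  define q where "q = b i * b (\<sigma> j) + b (\<sigma> i) * b j"
  define p' where "p' = polarize b i * polarize b j + polarize b (\<sigma> i) * polarize b (\<sigma> j)"
  define q' where "q' = polarize b i * polarize b (\<sigma> j) + polarize b (\<sigma> i) * polarize b j"
  have "p + q = (b i + b (\<sigma> i)) * (b j + b (\<sigma> j))" by (simp add: p_def q_def algebra_simps)
  also have "\<dots> = (polarize b i + polarize b (\<sigma> i)) * (polarize b j + polarize b (\<sigma> j))"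
    by (simp add: polarize_pair_sum)
  also have "\<dots> = p' + q'" by (simp add: p'_def q'_def algebra_simps)
  finally have tot: "p + q = p' + q'" .
  have swap: "p' = p \<and> q' = q \<or> p' = q \<and> q' = p"
    using polarize_cases[of b i] polarize_cases[of b j] by (auto simp: p_def q_def p'_def q'_def)
  have diff: "p' - q' = (polarize b i - polarize b (\<sigma> i)) * (polarize b j - polarize b (\<sigma> j))"
    by (simp add: p'_def q'_def algebra_simps)
  have sgn: "(if H k then 0 \<le> polarize b k - polarize b (\<sigma> k) else polarize b k - polarize b (\<sigma> k) \<le> 0)" for k
    using polarize_order[of k b] polarize_order[of "\<sigma> k" b] cover[of k] by auto
  have "p * W (i - j) + q * W (i - \<sigma> j) \<le> p' * W (i - j) + q' * W (i - \<sigma> j)"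
  proof (cases "H i = H j")
    case True
    have "0 \<le> p' - q'" unfolding diff using sgn[of i] sgn[of j] True
      by (cases "H i") (auto intro: mult_nonneg_nonneg mult_nonpos_nonpos)
    then have "p \<le> p'" using swap by auto
    moreover have "W (i - \<sigma> j) \<le> W (i - j)" by (intro W same_side True)
    ultimately have "0 \<le> (p' - p) * (W (i - j) - W (i - \<sigma> j))" by simp
    moreover have e: "q' = q - (p' - p)" using tot by simp
    ultimately show ?thesis unfolding e by (simp add: algebra_simps)
  next
    case False
    have "p' - q' \<le> 0" unfolding diff using sgn[of i] sgn[of j] False
      by (cases "H i") (auto intro: mult_nonneg_nonpos mult_nonpos_nonneg)
    then have "p' \<le> p" using swap by auto
    moreover have "W (i - j) \<le> W (i - \<sigma> j)" by (intro W other_side False)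
    ultimately have "0 \<le> (p' - p) * (W (i - j) - W (i - \<sigma> j))" by (simp add: mult_nonpos_nonpos)
    moreover have e: "q' = q - (p' - p)" using tot by simp
    ultimately show ?thesis unfolding e by (simp add: algebra_simps)
  qed
  then show ?thesis by (simp add: p_def q_def p'_def q'_def)
qed

text \<open>Averaging the double sum over \<open>\<sigma>\<close> in each variable writes it as a
  sum of the expressions in \<open>four_point\<close>; since \<open>\<sigma>\<close> is an isometry,
  the four distances that arise give only two values of \<open>W\<close>.\<close>

lemma form_polarize:
  assumes J: "\<sigma> ` J \<subseteq> J" and W: "\<And>i j. \<bar>i\<bar> \<le> \<bar>j\<bar> \<Longrightarrow> W j \<le> (W i :: real)"
  shows "(\<Sum>i\<in>J. \<Sum>j\<in>J. b i * b j * W (i - j))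
    \<le> (\<Sum>i\<in>J. \<Sum>j\<in>J. polarize b i * polarize b j * W (i - j))"
proof -
  have Wabs: "W i = W j" if "\<bar>i\<bar> = \<bar>j\<bar>" for i j
    using W[of i j] W[of j i] that by simp
  have four: "4 * (\<Sum>i\<in>J. \<Sum>j\<in>J. c i * c j * W (i - j)) =
    (\<Sum>i\<in>J. \<Sum>j\<in>J. (c i * c j + c (\<sigma> i) * c (\<sigma> j)) * W (i - j)
        + (c i * c (\<sigma> j) + c (\<sigma> i) * c j) * W (i - \<sigma> j))" for c :: "int \<Rightarrow> real"
  proof -
    have e1: "W (\<sigma> i - \<sigma> j) = W (i - j)" for i j by (intro Wabs isom)
    have e2: "W (\<sigma> i - j) = W (i - \<sigma> j)" for i j using e1[of i "\<sigma> j"] by simp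
    let ?f = "\<lambda>i j. c i * c j * W (i - j)"
    have "4 * (\<Sum>i\<in>J. \<Sum>j\<in>J. ?f i j) = 2 * (2 * (\<Sum>i\<in>J. \<Sum>j\<in>J. ?f i j))" by simp
    also have "\<dots> = 2 * (\<Sum>i\<in>J. (\<Sum>j\<in>J. ?f i j) + (\<Sum>j\<in>J. ?f (\<sigma> i) j))"
      by (subst sum_pair[OF J]) simp
    also have "\<dots> = (\<Sum>i\<in>J. 2 * (\<Sum>j\<in>J. ?f i j + ?f (\<sigma> i) j))"
      by (simp add: sum.distrib sum_distrib_left)
    also have "\<dots> = (\<Sum>i\<in>J. \<Sum>j\<in>J. (?f i j + ?f (\<sigma> i) j) + (?f i (\<sigma> j) + ?f (\<sigma> i) (\<sigma> j)))"
      by (subst sum_pair[OF J]) simp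
    finally show ?thesis by (simp add: e1 e2 algebra_simps)
  qed
  have "4 * (\<Sum>i\<in>J. \<Sum>j\<in>J. b i * b j * W (i - j))
    \<le> 4 * (\<Sum>i\<in>J. \<Sum>j\<in>J. polarize b i * polarize b j * W (i - j))"
    unfolding four by (intro sum_mono four_point W)
  then show ?thesis by simp
qed

end

interpretation refl0: reflection "\<lambda>i. - i" "\<lambda>i. 0 \<le> i"
  by standard auto

text \<open>Here the larger value goes to the nonpositive index, against the direction of
  \<open>refl0\<close>. Being fixed by both reflections therefore interlaces the two half-lines into
  the single chain 0, 1, -1, 2, -2 and so on.\<close>

interpretation refl1: reflection "\<lambda>i. 1 - i" "\<lambda>i. i \<le> 0"
  by standard auto

text \<open>No sequence of polarizations is iterated: a potential that every effective polarization
  strictly increases, on a finite set of candidates, replaces a termination argument.\<close>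

lemma discrete_riesz:
  fixes a :: "int \<Rightarrow> real" and W :: "int \<Rightarrow> real"
  assumes a0: "\<And>i. 0 \<le> a i" and aN: "\<And>i. i \<notin> {-N..N} \<Longrightarrow> a i = 0"
    and W: "\<And>i j. \<bar>i\<bar> \<le> \<bar>j\<bar> \<Longrightarrow> W j \<le> W i"
  obtains b where "\<And>i. 0 \<le> b i" "\<And>i. i \<notin> {-N..N} \<Longrightarrow> b i = 0"
    "\<And>g. (\<Sum>i\<in>{-N..N}. g (b i)) = (\<Sum>i\<in>{-N..N}. g (a i) :: real)"
    "(\<Sum>i\<in>{-N..N}. \<Sum>j\<in>{-N..N}. a i * a j * W (i - j))
      \<le> (\<Sum>i\<in>{-N..N}. \<Sum>j\<in>{-N..N}. b i * b j * W (i - j))"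
    "\<And>i. 0 \<le> i \<Longrightarrow> b (- i) \<le> b i" "\<And>i. 0 \<le> i \<Longrightarrow> b (i + 1) \<le> b (- i)"
proof -
  define Q where "Q b = (\<Sum>i\<in>{-N..N}. \<Sum>j\<in>{-N..N}. b i * b j * W (i - j))" for b :: "int \<Rightarrow> real"
  \<comment> \<open>The values at 0, 1, -1, 2, -2 are 0, -1, -2, -3, -4: \<open>\<rho>\<close> ranks
    the integers in the intended order, so for both reflections it is larger on the side of
    \<open>H\<close>.\<close>
  define \<rho> where "\<rho> i = real_of_int (if 0 < i then 1 - 2 * i else 2 * i)" for i
  define \<Phi> where "\<Phi> b = (\<Sum>i\<in>{-N..N}. \<rho> i * b i)" for b
  define V where "V = insert 0 (a ` {-N..N})"
  \<comment> \<open>Equality of the sums for every \<open>g\<close> says that \<open>b\<close> takes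
    the values of \<open>a\<close> with the same multiplicities; membership in \<open>V\<close>
    makes the set finite.\<close>
  define X where "X = {b. (\<forall>i. (i \<in> {-N..N} \<longrightarrow> b i \<in> V) \<and> (i \<notin> {-N..N} \<longrightarrow> b i = 0)) \<and>
    (\<forall>g. (\<Sum>i\<in>{-N..N}. g (b i)) = (\<Sum>i\<in>{-N..N}. g (a i) :: real))}"
  have "finite X"
    by (rule finite_subset[OF _ finite_set_of_finite_funs[of "{-N..N}" V 0]])
      (auto simp: X_def V_def)
  have "a \<in> X" using aN by (auto simp: X_def V_def)
  have widen: "(\<Sum>i\<in>{-N..N+1}. f i) = (\<Sum>i\<in>{-N..N}. f i)" if "\<And>i. i \<notin> {-N..N} \<Longrightarrow> f i = 0"
    for f :: "int \<Rightarrow> real"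
    by (rule sum.mono_neutral_right) (use that in auto)
  have XV: "b i \<in> V" if "b \<in> X" for b i
    using that by (cases "i \<in> {-N..N}") (auto simp: X_def V_def)
  have Xout: "b i = 0" if "b \<in> X" "i \<notin> {-N..N}" for b i using that by (auto simp: X_def)
  have Xnn: "0 \<le> b i" if "b \<in> X" for b i
    using XV[OF that, of i] a0 by (auto simp: V_def)
  have pol0: "refl0.polarize b \<in> X \<and> Q b \<le> Q (refl0.polarize b) \<and>
     (refl0.polarize b \<noteq> b \<longrightarrow> \<Phi> b < \<Phi> (refl0.polarize b))" if b: "b \<in> X" for b
  proof -
    have J: "uminus ` {-N..N} \<subseteq> {-N..N}" by auto
    have out: "refl0.polarize b i = 0" if "i \<notin> {-N..N}" for i
      using that Xout[OF b, of i] Xout[OF b, of "-i"] by (auto simp: refl0.polarize_def)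
    have "refl0.polarize b i \<in> V" for i
      using XV[OF b] by (auto simp: refl0.polarize_def max_def min_def)
    then have "refl0.polarize b \<in> X"
      using b out refl0.sum_polarize[OF J] by (auto simp: X_def)
    moreover have "Q b \<le> Q (refl0.polarize b)"
      unfolding Q_def by (rule refl0.form_polarize[OF J W])
    moreover have "\<Phi> b < \<Phi> (refl0.polarize b)" if ne: "refl0.polarize b \<noteq> b"
    proof -
      obtain j where j: "refl0.polarize b j \<noteq> b j" using ne by (auto simp: fun_eq_iff)
      then have "j \<in> {-N..N}" using out[of j] Xout[OF b, of j] by metis
      then show ?thesis unfolding \<Phi>_def using j
        by (intro refl0.weighted_sum_polarize[OF J]) (auto simp: \<rho>_def)
    qed
    ultimately show ?thesis by blast
  qed
  have pol1: "refl1.polarize b \<in> X \<and> Q b \<le> Q (refl1.polarize b) \<and>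
     (refl1.polarize b \<noteq> b \<longrightarrow> \<Phi> b < \<Phi> (refl1.polarize b))" if b: "b \<in> X" for b
  proof -
    have J: "(\<lambda>i. 1 - i) ` {-N..N+1} \<subseteq> {-N..N+1}" by auto
    have out: "refl1.polarize b i = 0" if i: "i \<notin> {-N..N}" for i
    \<comment> \<open>The reflection at 1/2 sends \<open>- N\<close> to \<open>N + 1\<close>, just
      outside the window. As \<open>N + 1\<close> is not in \<open>H\<close>, it receives the
      minimum of 0 and a nonnegative value, so the support does not grow.\<close>
    proof (cases "i = N + 1 \<and> 0 \<le> N")
      case True
      then show ?thesis using Xout[OF b i] Xnn[OF b, of "1 - i"] by (simp add: refl1.polarize_def)
    next
      case False
      then have "1 - i \<notin> {-N..N}" using i by auto
      then show ?thesis using Xout[OF b, of i] i Xout[OF b, of "1-i"] by (simp add: refl1.polarize_def)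
    qed
    have widen2: "(\<Sum>i\<in>{-N..N}. \<Sum>j\<in>{-N..N}. c i * c j * W (i - j)) = (\<Sum>i\<in>{-N..N+1}. \<Sum>j\<in>{-N..N+1}. c i * c j * W (i - j))"
      if "\<And>i. i \<notin> {-N..N} \<Longrightarrow> c i = 0" for c
      using that by (subst widen) (auto intro!: sum.cong widen[symmetric])
    have V: "refl1.polarize b i \<in> V" for i
      using XV[OF b] by (auto simp: refl1.polarize_def max_def min_def)
    have "(\<Sum>i\<in>{-N..N}. g (refl1.polarize b i)) = (\<Sum>i\<in>{-N..N}. g (a i))" for g :: "real \<Rightarrow> real"
    proof -
      \<comment> \<open>The additional index carries the value 0 before and after the move, so it
        adds the same \<open>g 0\<close> to both sums. The condition says that the enlarged interval
        is nonempty.\<close>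
      have *: "(\<Sum>i\<in>{-N..N+1}. g (c i)) = (\<Sum>i\<in>{-N..N}. g (c i)) + (if 0 \<le> N + 1 + N then g 0 else 0)" if "c (N + 1) = 0" for c :: "int \<Rightarrow> real"
      proof (cases "0 \<le> N + 1 + N")
        case True
        then have "{-N..N+1} = insert (N+1) {-N..N}" by auto
        then show ?thesis using True that by simp
      qed (use that in auto)
      have "(\<Sum>i\<in>{-N..N+1}. g (refl1.polarize b i)) = (\<Sum>i\<in>{-N..N+1}. g (b i))"
        by (rule refl1.sum_polarize[OF J])
      then have "(\<Sum>i\<in>{-N..N}. g (refl1.polarize b i)) = (\<Sum>i\<in>{-N..N}. g (b i))"
        using *[of b] *[of "refl1.polarize b"] out[of "N+1"] Xout[OF b, of "N+1"] by simp
      also have "\<dots> = (\<Sum>i\<in>{-N..N}. g (a i))" using b by (simp add: X_def)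
      finally show ?thesis .
    qed
    then have "refl1.polarize b \<in> X" using b out V by (auto simp: X_def)
    moreover have "Q b \<le> Q (refl1.polarize b)"
      unfolding Q_def using out Xout[OF b]
      by (subst (1 2) widen2) (auto intro!: refl1.form_polarize[OF J W])
    moreover have "\<Phi> b < \<Phi> (refl1.polarize b)" if ne: "refl1.polarize b \<noteq> b"
    proof -
      obtain j where j: "refl1.polarize b j \<noteq> b j" using ne by (auto simp: fun_eq_iff)
      then have "j \<in> {-N..N}" using out[of j] Xout[OF b, of j] by metis
      then have jj: "j \<in> {-N..N+1}" by auto
      have "(\<Sum>i\<in>{-N..N+1}. \<rho> i * b i) < (\<Sum>i\<in>{-N..N+1}. \<rho> i * refl1.polarize b i)"
        using j jj
        by (intro refl1.weighted_sum_polarize[OF J]) (auto simp: \<rho>_def)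
      then show ?thesis unfolding \<Phi>_def
        using widen[of "\<lambda>i. \<rho> i * b i"] widen[of "\<lambda>i. \<rho> i * refl1.polarize b i"] out Xout[OF b] by simp
    qed
    ultimately show ?thesis by blast
  qed
  \<comment> \<open>A lexicographic maximizer of \<open>(Q, \<Phi>)\<close> on the finite set \<open>X\<close> is fixed by both polarizations.\<close>
  obtain b0 where b0: "b0 \<in> X" "\<And>c. c \<in> X \<Longrightarrow> Q c \<le> Q b0"
    using obtains_MAX[of X Q] Max_ge[of "Q ` X"] \<open>finite X\<close> \<open>a \<in> X\<close>
    by (metis emptyE finite_imageI imageI)
  define Y where "Y = {b \<in> X. Q b = Q b0}"
  have "finite Y" "b0 \<in> Y" using \<open>finite X\<close> b0 by (auto simp: Y_def)
  then obtain b where b: "b \<in> Y" "\<And>c. c \<in> Y \<Longrightarrow> \<Phi> c \<le> \<Phi> b"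
    using obtains_MAX[of Y \<Phi>] Max_ge[of "\<Phi> ` Y"] by (metis emptyE finite_imageI imageI)
  have bX: "b \<in> X" "Q b = Q b0" using b(1) by (auto simp: Y_def)
  have "refl0.polarize b \<in> Y"
    using pol0[OF bX(1)] b0(2)[of "refl0.polarize b"] bX by (auto simp: Y_def)
  then have fix0: "refl0.polarize b = b" using pol0[OF bX(1)] b(2) by force
  have "refl1.polarize b \<in> Y"
    using pol1[OF bX(1)] b0(2)[of "refl1.polarize b"] bX by (auto simp: Y_def)
  then have fix1: "refl1.polarize b = b" using pol1[OF bX(1)] b(2) by force
  show thesis
  proof
    show "b (- i) \<le> b i" if "0 \<le> i" for i
      using refl0.polarize_order[of i b] that fix0 by simp
    show "b (i + 1) \<le> b (- i)" if "0 \<le> i" for i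
      using refl1.polarize_order[of "-i" b] that fix1 by (simp add: add.commute)
    show "(\<Sum>i\<in>{-N..N}. g (b i)) = (\<Sum>i\<in>{-N..N}. g (a i))" for g :: "real \<Rightarrow> real"
      using bX(1) by (simp add: X_def)
    show "(\<Sum>i = - N..N. \<Sum>j = - N..N. a i * a j * W (i - j))
    \<le> (\<Sum>i = - N..N. \<Sum>j = - N..N. b i * b j * W (i - j))"
      using b0(2)[OF \<open>a \<in> X\<close>] bX by (simp add: Q_def)
  qed (use Xnn Xout bX in auto)
qed

section \<open>The quadratic form\<close>

lemma AE_lborel_pair:
  fixes P :: "real \<Rightarrow> bool"
  assumes "AE x in lborel. P x"
  shows "AE p in lborel \<Otimes>\<^sub>M lborel. P (fst p) \<and> P (snd p)"
proof -
  obtain N where N: "{x. \<not> P x} \<subseteq> N" "N \<in> sets lborel" "emeasure lborel N = 0"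
    using AE_E[OF assms] by auto
  have "emeasure (lborel \<Otimes>\<^sub>M lborel) (N \<times> UNIV) = 0" "emeasure (lborel \<Otimes>\<^sub>M lborel) (UNIV \<times> N) = 0"
    using N by (simp_all add: lborel.emeasure_pair_measure_Times)
  then have null: "N \<times> UNIV \<in> null_sets (lborel \<Otimes>\<^sub>M lborel)" "UNIV \<times> N \<in> null_sets (lborel \<Otimes>\<^sub>M lborel)"
    using N(2) by auto
  have "AE p in lborel \<Otimes>\<^sub>M lborel. P (fst p)"
    by (rule AE_I'[OF null(1)]) (use N(1) in auto)
  moreover have "AE p in lborel \<Otimes>\<^sub>M lborel. P (snd p)"
    by (rule AE_I'[OF null(2)]) (use N(1) in auto)
  ultimately show ?thesis by auto
qed

lemma Lp_norm_1: "Lp_norm 1 f = (\<integral>x. \<bar>f x\<bar> \<partial>lebesgue)"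
  by (simp add: Lp_norm_def)

lemma Lp_norm_2: "Lp_norm 2 f = sqrt (\<integral>x. (f x)\<^sup>2 \<partial>lebesgue)"
  by (simp add: Lp_norm_def powr_half_sqrt)

lemma in_Lp_1: "in_Lp 1 f \<longleftrightarrow> integrable lebesgue f"
  unfolding in_Lp_def by (auto intro: integrable_norm_cancel[where 'b=real])

lemma in_Lp_2: "in_Lp 2 f \<longleftrightarrow> f \<in> borel_measurable lebesgue \<and> integrable lebesgue (\<lambda>x. (f x)\<^sup>2)"
  unfolding in_Lp_def by simp

text \<open>Integrability over \<open>lborel\<close> includes Borel measurability, so that Fubini on
  the product measure is available throughout; Lebesgue measurable functions return only at the
  end.\<close>

definition L12 :: "(real \<Rightarrow> real) \<Rightarrow> bool" where
  "L12 f \<longleftrightarrow> integrable lborel f \<and> integrable lborel (\<lambda>x. (f x)\<^sup>2)"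

abbreviation N1 :: "(real \<Rightarrow> real) \<Rightarrow> real" where
  "N1 f \<equiv> \<integral>x. \<bar>f x\<bar> \<partial>lborel"

abbreviation N2 :: "(real \<Rightarrow> real) \<Rightarrow> real" where
  "N2 f \<equiv> sqrt (\<integral>x. (f x)\<^sup>2 \<partial>lborel)"

lemma L12_measurable [measurable_dest]: "L12 f \<Longrightarrow> f \<in> borel_measurable borel"
  by (auto simp: L12_def)

lemma L12_dominated:
  assumes G: "L12 G" and [measurable]: "g \<in> borel_measurable borel" and le: "\<And>x. \<bar>g x\<bar> \<le> \<bar>G x\<bar>"
  shows "L12 g"
proof -
  have "integrable lborel g"
    by (rule Bochner_Integration.integrable_bound[of lborel G]) (use G le in \<open>auto simp: L12_def\<close>)
  moreover have "integrable lborel (\<lambda>x. (g x)\<^sup>2)"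
    by (rule Bochner_Integration.integrable_bound[of lborel "\<lambda>x. (G x)\<^sup>2"])
      (use G le in \<open>auto simp: L12_def abs_le_square_iff\<close>)
  ultimately show ?thesis by (simp add: L12_def)
qed

lemma L12_indicator: "L12 (\<lambda>x. c * indicator {a..b} x)"
proof -
  have "(\<lambda>x. (c * indicator {a..b} x)\<^sup>2) = (\<lambda>x. c\<^sup>2 * indicator {a..b} x :: real)"
    by (auto simp: indicator_def)
  then show ?thesis unfolding L12_def by (auto simp: emeasure_lborel_Icc_eq)
qed

lemma in_Lp_L12:
  assumes "f \<in> borel_measurable borel"
  shows "in_Lp 1 f \<and> in_Lp 2 f \<longleftrightarrow> L12 f"
  using assms unfolding in_Lp_1 in_Lp_2 L12_def
  by (auto simp: integrable_completion measurable_completion)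

lemma Lp_norm_lborel:
  assumes "f \<in> borel_measurable borel"
  shows "Lp_norm 1 f = N1 f" "Lp_norm 2 f = N2 f"
  using assms by (simp_all add: Lp_norm_1 Lp_norm_2 integral_completion)

locale kernel =
  fixes w :: "real \<Rightarrow> real"
  assumes sym_decr: "symmetric_decreasing w"
    and int_w: "integrable lborel w"
    and total_w: "(\<integral>x. w x \<partial>lborel) = 1"
begin

lemma w_nonneg [simp]: "0 \<le> w x" and w_even: "w (- x) = w x"
  and w_anti: "\<bar>x\<bar> \<le> \<bar>y\<bar> \<Longrightarrow> w y \<le> w x"
  using sym_decr by (auto simp: symmetric_decreasing_def)

lemma w_le_0: "w x \<le> w 0" by (rule w_anti) simp

lemma w_swap: "w (x - y) = w (y - x)" using w_even[of "x - y"] by simp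

lemma w_measurable [measurable]: "w \<in> borel_measurable borel"
  using int_w by auto

lemma w_shift: "integrable lborel (\<lambda>y. w (x - y))" "(\<integral>y. w (x - y) \<partial>lborel) = 1"
  using lborel_integrable_real_affine[OF int_w, of "-1" x]
    lborel_integral_real_affine[of "-1" w x] total_w
  by simp_all

definition Q :: "(real \<Rightarrow> real) \<Rightarrow> real" where
  "Q f = (\<integral>p. f (fst p) * f (snd p) * w (fst p - snd p) \<partial>(lborel \<Otimes>\<^sub>M lborel))"

text \<open>The product of the exceptional null set with a line is null in the plane, so the two
  integrands agree almost everywhere there, and completeness of the planar measure carries
  measurability over.\<close>

lemma conv_form_cong:
  assumes ae: "AE x in lborel. f x = g x" and [measurable]: "g \<in> borel_measurable borel"
    and f: "f \<in> borel_measurable lebesgue"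
  shows "conv_form w f = Q g"
proof -
  let ?k = "\<lambda>p. g (fst p) * g (snd p) * w (fst p - snd p)"
  have m: "?k \<in> borel_measurable (lborel \<Otimes>\<^sub>M lborel)" by measurable
  then have m': "?k \<in> borel_measurable lborel" by (simp add: lborel_prod)
  have ae2: "AE p in (lebesgue :: (real \<times> real) measure). (case p of (x, y) \<Rightarrow> f x * f y * w (x - y)) = ?k p"
    using AE_lborel_pair[OF ae] unfolding lborel_prod
    by (intro AE_completion, eventually_elim) (auto simp: split_beta)
  have "?k \<in> borel_measurable lebesgue" using m' by (rule measurable_completion)
  then have "(\<lambda>(x, y). f x * f y * w (x - y)) \<in> borel_measurable lebesgue"
    by (rule borel_measurable_AE) (use ae2 in \<open>auto elim!: eventually_mono\<close>)
  then have "conv_form w f = integral\<^sup>L lebesgue ?k"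
    unfolding conv_form_def
    by (intro integral_cong_AE ae2 \<open>?k \<in> borel_measurable lebesgue\<close>)
  also have "\<dots> = Q g" unfolding Q_def by (simp add: integral_completion[OF m'] lborel_prod)
  finally show ?thesis .
qed

lemma Q_cong:
  assumes ae: "AE x in lborel. f x = g x" and [measurable]: "g \<in> borel_measurable borel"
    and [measurable]: "f \<in> borel_measurable borel"
  shows "Q f = Q g"
  unfolding Q_def
proof (intro integral_cong_AE)
  show "AE p in lborel \<Otimes>\<^sub>M lborel. f (fst p) * f (snd p) * w (fst p - snd p) = g (fst p) * g (snd p) * w (fst p - snd p)"
    using AE_lborel_pair[OF ae] by eventually_elim auto
qed measurable

text \<open>Integrating out the variable that occurs only in \<open>w\<close> leaves the total mass
  1 of the kernel.\<close>

lemma integrable_fst_w: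
  assumes "integrable lborel u"
  shows "integrable (lborel \<Otimes>\<^sub>M lborel) (\<lambda>p. u (fst p) * w (fst p - snd p))"
    and "integrable (lborel \<Otimes>\<^sub>M lborel) (\<lambda>p. u (snd p) * w (fst p - snd p))"
    and "(\<integral>p. u (fst p) * w (fst p - snd p) \<partial>(lborel \<Otimes>\<^sub>M lborel)) = (\<integral>x. u x \<partial>lborel)"
    and "(\<integral>p. u (snd p) * w (fst p - snd p) \<partial>(lborel \<Otimes>\<^sub>M lborel)) = (\<integral>x. u x \<partial>lborel)"
proof -
  note [measurable] = borel_measurable_integrable[OF assms]
  show 1: "integrable (lborel \<Otimes>\<^sub>M lborel) (\<lambda>p. u (fst p) * w (fst p - snd p))"
    by (rule lborel_pair.Fubini_integrable) (use assms w_shift in \<open>auto simp: abs_mult\<close>)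
  have e: "(\<lambda>(x, y). case (y, x) of p \<Rightarrow> u (fst p) * w (fst p - snd p)) = (\<lambda>p. u (snd p) * w (fst p - snd p))"
    by (auto simp: w_swap)
  show 2: "integrable (lborel \<Otimes>\<^sub>M lborel) (\<lambda>p. u (snd p) * w (fst p - snd p))"
    using lborel_pair.integrable_product_swap[OF 1] e by (simp add: split_beta')
  show 3: "(\<integral>p. u (fst p) * w (fst p - snd p) \<partial>(lborel \<Otimes>\<^sub>M lborel)) = (\<integral>x. u x \<partial>lborel)"
    using lborel_pair.integral_fst'[OF 1] by (simp add: w_shift)
  show "(\<integral>p. u (snd p) * w (fst p - snd p) \<partial>(lborel \<Otimes>\<^sub>M lborel)) = (\<integral>x. u x \<partial>lborel)"
    using lborel_pair.integral_product_swap[of "\<lambda>p. u (fst p) * w (fst p - snd p)"] e 3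
    by (simp add: split_beta')
qed

lemma integrable_tensor:
  assumes "integrable lborel u" "integrable lborel v"
  shows "integrable (lborel \<Otimes>\<^sub>M lborel) (\<lambda>p. u (fst p) * v (snd p) :: real)"
    and "(\<integral>p. u (fst p) * v (snd p) \<partial>(lborel \<Otimes>\<^sub>M lborel)) = (\<integral>x. u x \<partial>lborel) * (\<integral>x. v x \<partial>lborel)"
proof -
  note [measurable] = assms[THEN borel_measurable_integrable]
  show 1: "integrable (lborel \<Otimes>\<^sub>M lborel) (\<lambda>p. u (fst p) * v (snd p))"
    by (rule lborel_pair.Fubini_integrable) (use assms in \<open>auto simp: abs_mult\<close>)
  show "(\<integral>p. u (fst p) * v (snd p) \<partial>(lborel \<Otimes>\<^sub>M lborel)) = (\<integral>x. u x \<partial>lborel) * (\<integral>x. v x \<partial>lborel)"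
    using lborel_pair.integral_fst'[OF 1] by simp
qed

lemma integrable_form:
  assumes "integrable lborel u" "integrable lborel v"
  shows "integrable (lborel \<Otimes>\<^sub>M lborel) (\<lambda>p. u (fst p) * v (snd p) * w (fst p - snd p))"
proof -
  note [measurable] = assms[THEN borel_measurable_integrable]
  show ?thesis
    by (rule Bochner_Integration.integrable_bound
        [OF integrable_mult_right[OF integrable_tensor(1)[OF assms], of "w 0"]])
      (auto simp: abs_mult mult.commute[of "w 0"] intro!: mult_left_mono w_le_0)
qed

lemma Q_le_N1: assumes "L12 f" shows "Q f \<le> w 0 * (N1 f)\<^sup>2"
proof -
  have i: "integrable lborel f" "integrable lborel (\<lambda>x. \<bar>f x\<bar>)" using assms by (auto simp: L12_def)
  have "Q f \<le> (\<integral>p. w 0 * (\<bar>f (fst p)\<bar> * \<bar>f (snd p)\<bar>) \<partial>(lborel \<Otimes>\<^sub>M lborel))"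
    unfolding Q_def
  proof (rule integral_mono)
    fix p
    have "f (fst p) * f (snd p) * w (fst p - snd p) \<le> \<bar>f (fst p) * f (snd p)\<bar> * w 0"
      by (intro mult_mono w_le_0) auto
    then show "f (fst p) * f (snd p) * w (fst p - snd p) \<le> w 0 * (\<bar>f (fst p)\<bar> * \<bar>f (snd p)\<bar>)"
      by (simp add: abs_mult mult_ac)
  qed (use integrable_form[OF i(1) i(1)] integrable_tensor(1)[OF i(2) i(2)] in auto)
  also have "\<dots> = w 0 * (N1 f)\<^sup>2"
    using integrable_tensor(2)[OF i(2) i(2)] by (simp add: power2_eq_square)
  finally show ?thesis .
qed

text \<open>By \<open>2 a b <= a^2 + b^2\<close> under the kernel; each square then integrates to
  the squared norm because the kernel has mass 1.\<close>

lemma Q_le_N2: assumes "L12 f" shows "Q f \<le> (N2 f)\<^sup>2"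
proof -
  have i: "integrable lborel f" "integrable lborel (\<lambda>x. (f x)\<^sup>2)" using assms by (auto simp: L12_def)
  note j = integrable_fst_w[OF i(2)]
  have "Q f \<le> (\<integral>p. 1/2 * ((f (fst p))\<^sup>2 * w (fst p - snd p) + (f (snd p))\<^sup>2 * w (fst p - snd p)) \<partial>(lborel \<Otimes>\<^sub>M lborel))"
    unfolding Q_def
  proof (rule integral_mono)
    fix p
    have "2 * (f (fst p) * f (snd p)) \<le> (f (fst p))\<^sup>2 + (f (snd p))\<^sup>2"
      using sum_squares_bound[of "f (fst p)" "f (snd p)"] by simp
    then have "2 * (f (fst p) * f (snd p)) * w (fst p - snd p) \<le> ((f (fst p))\<^sup>2 + (f (snd p))\<^sup>2) * w (fst p - snd p)"
      by (rule mult_right_mono) simp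
    then show "f (fst p) * f (snd p) * w (fst p - snd p) \<le> 1/2 * ((f (fst p))\<^sup>2 * w (fst p - snd p) + (f (snd p))\<^sup>2 * w (fst p - snd p))"
      by (simp add: algebra_simps)
  qed (use integrable_form[OF i(1) i(1)] j in auto)
  also have "\<dots> = (\<integral>x. (f x)\<^sup>2 \<partial>lborel)"
    using j by simp
  finally show ?thesis by simp
qed

text \<open>The geometric mean of the two preceding bounds; it makes the best constant
  finite.\<close>

lemma Q_bound: assumes "L12 f" shows "Q f \<le> sqrt (w 0) * N1 f * N2 f"
proof (cases "Q f \<le> 0")
  case True
  moreover have "0 \<le> sqrt (w 0) * N1 f * N2 f" by (intro mult_nonneg_nonneg) auto
  ultimately show ?thesis by linarith
next
  case False
  have "(Q f)\<^sup>2 \<le> (w 0 * (N1 f)\<^sup>2) * (N2 f)\<^sup>2"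
    unfolding power2_eq_square[of "Q f"] using False Q_le_N1[OF assms] Q_le_N2[OF assms]
    by (intro mult_mono) auto
  also have "\<dots> = (sqrt (w 0) * N1 f * N2 f)\<^sup>2" by (simp add: power_mult_distrib)
  finally show ?thesis by (rule power2_le_imp_le) (intro mult_nonneg_nonneg; simp)
qed

text \<open>Otherwise \<open>w\<close> would vanish away from 0, hence almost everywhere, against
  its total mass 1.\<close>

lemma w_pos_near_0: obtains r where "0 < r" "0 < w r"
proof -
  have "\<exists>x. x \<noteq> 0 \<and> 0 < w x"
  proof (rule ccontr)
    assume "\<not> ?thesis"
    then have "w x = 0" if "x \<noteq> 0" for x using that w_nonneg[of x] by (metis less_le)
    then have "AE x in lborel. w x = 0"
      using AE_lborel_singleton[of 0] by (auto elim!: eventually_mono)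
    then have "(\<integral>x. w x \<partial>lborel) = 0" by (intro integral_eq_zero_AE)
    then show False using total_w by simp
  qed
  then obtain x where "x \<noteq> 0" "0 < w x" by auto
  then show ?thesis using that[of "\<bar>x\<bar>"] w_anti[of "\<bar>x\<bar>" x] by force
qed

text \<open>Two points of \<open>{0..r}\<close> are at most \<open>r\<close> apart, so the kernel is
  at least \<open>w r\<close> on the square over this interval.\<close>

lemma ex_Q_pos: "\<exists>f. L12 f \<and> 0 < Q f"
proof -
  obtain r where r: "0 < r" "0 < w r" by (rule w_pos_near_0)
  define f where "f = (\<lambda>x. 1 * indicator {0..r} x :: real)"
  have f: "L12 f" unfolding f_def by (rule L12_indicator)
  then have i: "integrable lborel f" by (simp add: L12_def)
  have "(\<integral>p. w r * (f (fst p) * f (snd p)) \<partial>(lborel \<Otimes>\<^sub>M lborel)) \<le> Q f"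
    unfolding Q_def
  proof (rule integral_mono)
    show "w r * (f (fst p) * f (snd p)) \<le> f (fst p) * f (snd p) * w (fst p - snd p)" for p
      by (auto simp: f_def indicator_def intro!: w_anti)
  qed (use integrable_form[OF i i] integrable_tensor(1)[OF i i] in auto)
  moreover have "(\<integral>p. w r * (f (fst p) * f (snd p)) \<partial>(lborel \<Otimes>\<^sub>M lborel)) = w r * (r * r)"
    using r integrable_tensor(2)[OF i i] by (simp add: f_def)
  ultimately show ?thesis using f r by (intro exI[of _ f]) (auto intro: less_le_trans[of 0 "w r * (r * r)"])
qed

end

section \<open>Step functions\<close>

context kernel
begin

section \<open>Near-optimality under dominated pointwise approximation\<close>

lemma dominated_limit:
  assumes G: "L12 G" and [measurable]: "\<And>n. g n \<in> borel_measurable borel" "g' \<in> borel_measurable borel"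
    and le: "\<And>n x. \<bar>g n x\<bar> \<le> \<bar>G x\<bar>"
    and lim: "AE x in lborel. (\<lambda>n. g n x) \<longlonglongrightarrow> g' x"
  shows "(\<lambda>n. Q (g n)) \<longlonglongrightarrow> Q g'" "(\<lambda>n. N1 (g n)) \<longlonglongrightarrow> N1 g'" "(\<lambda>n. N2 (g n)) \<longlonglongrightarrow> N2 g'"
proof -
  note [measurable] = L12_measurable[OF G]
  have i: "integrable lborel (\<lambda>x. \<bar>G x\<bar>)" "integrable lborel (\<lambda>x. (G x)\<^sup>2)" using G by (auto simp: L12_def)
  show "(\<lambda>n. Q (g n)) \<longlonglongrightarrow> Q g'" unfolding Q_def
  proof (rule integral_dominated_convergence)
    show "integrable (lborel \<Otimes>\<^sub>M lborel) (\<lambda>p. \<bar>G (fst p)\<bar> * \<bar>G (snd p)\<bar> * w (fst p - snd p))"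
      by (rule integrable_form[OF i(1) i(1)])
    show "AE p in lborel \<Otimes>\<^sub>M lborel. (\<lambda>n. g n (fst p) * g n (snd p) * w (fst p - snd p))
       \<longlonglongrightarrow> g' (fst p) * g' (snd p) * w (fst p - snd p)"
      using AE_lborel_pair[OF lim] by eventually_elim (auto intro!: tendsto_intros)
    show "AE p in lborel \<Otimes>\<^sub>M lborel. norm (g n (fst p) * g n (snd p) * w (fst p - snd p))
       \<le> \<bar>G (fst p)\<bar> * \<bar>G (snd p)\<bar> * w (fst p - snd p)" for n
      by (auto simp: abs_mult intro!: AE_I2 mult_right_mono mult_mono le)
  qed measurable
  show "(\<lambda>n. N1 (g n)) \<longlonglongrightarrow> N1 g'"
    by (rule integral_dominated_convergence[OF _ _ i(1)])
      (use lim le in \<open>auto elim!: eventually_mono intro: tendsto_rabs\<close>)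
  have "(\<lambda>n. \<integral>x. (g n x)\<^sup>2 \<partial>lborel) \<longlonglongrightarrow> (\<integral>x. (g' x)\<^sup>2 \<partial>lborel)"
    by (rule integral_dominated_convergence[OF _ _ i(2)])
      (use lim le in \<open>auto elim!: eventually_mono intro: tendsto_power simp: abs_le_square_iff\<close>)
  then show "(\<lambda>n. N2 (g n)) \<longlonglongrightarrow> N2 g'" by (rule tendsto_real_sqrt)
qed

text \<open>Because the inequality is strict, the approximations below by bounded, continuous and
  step functions can all keep the same constant \<open>c\<close>.\<close>

lemma ratio_open:
  assumes "L12 G" "\<And>n. g n \<in> borel_measurable borel" "g' \<in> borel_measurable borel"
    and "\<And>n x. \<bar>g n x\<bar> \<le> \<bar>G x\<bar>"
    and "AE x in lborel. (\<lambda>n. g n x) \<longlonglongrightarrow> g' x"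
    and "c * N1 g' * N2 g' < Q g'"
  shows "\<forall>\<^sub>F n in sequentially. c * N1 (g n) * N2 (g n) < Q (g n)"
proof -
  note l = dominated_limit[OF assms(1-5)]
  have "(\<lambda>n. Q (g n) - c * N1 (g n) * N2 (g n)) \<longlonglongrightarrow> Q g' - c * N1 g' * N2 g'"
    by (intro tendsto_intros l)
  then have "\<forall>\<^sub>F n in sequentially. 0 < Q (g n) - c * N1 (g n) * N2 (g n)"
    using assms(6) by (intro order_tendstoD) auto
  then show ?thesis by eventually_elim simp
qed

lemma approx_bounded:
  assumes f: "L12 f" and r: "c * N1 f * N2 f < Q f"
  obtains n :: nat and g where "g \<in> borel_measurable borel" "\<And>x. 0 \<le> g x"
    "\<And>x. g x \<le> real n * indicator {- real n..<n} x" "c * N1 g * N2 g < Q g"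
proof -
  note [measurable] = L12_measurable[OF f]
  have i: "integrable lborel f" "integrable lborel (\<lambda>x. \<bar>f x\<bar>)" using f by (auto simp: L12_def)
  \<comment> \<open>As \<open>w\<close> is nonnegative, passing to the absolute value does not lower
    the form, and it leaves both norms alone.\<close>
  have "Q f \<le> Q (\<lambda>x. \<bar>f x\<bar>)" unfolding Q_def
    by (rule integral_mono[OF integrable_form[OF i(1) i(1)] integrable_form[OF i(2) i(2)]])
      (auto simp flip: abs_mult intro!: mult_right_mono)
  then have r': "c * N1 (\<lambda>x. \<bar>f x\<bar>) * N2 (\<lambda>x. \<bar>f x\<bar>) < Q (\<lambda>x. \<bar>f x\<bar>)" using r by simp
  \<comment> \<open>The window is half-open with integer end points so that it will later be an
    exact union of half-open grid cells.\<close>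
  define g where "g n x = min \<bar>f x\<bar> n * indicator {- real n..<n} x" for n :: nat and x
  have "(\<lambda>n. g n x) \<longlonglongrightarrow> \<bar>f x\<bar>" for x
  proof (rule tendsto_eventually)
    obtain m :: nat where m: "\<bar>f x\<bar> + \<bar>x\<bar> < m" using reals_Archimedean2 by blast
    show "\<forall>\<^sub>F n in sequentially. g n x = \<bar>f x\<bar>"
      using eventually_ge_at_top[of m]
    proof eventually_elim
      case (elim n)
      then have "real m \<le> real n" by simp
      then show ?case using m by (auto simp: g_def indicator_def)
    qed
  qed
  then have "\<forall>\<^sub>F n in sequentially. c * N1 (g n) * N2 (g n) < Q (g n)"
    by (intro ratio_open[OF f _ _ _ _ r']) (auto simp: g_def[abs_def] indicator_def)
  then obtain n where "c * N1 (g n) * N2 (g n) < Q (g n)" by (auto simp: eventually_sequentially)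
  then show thesis
    by (intro that[of "g n" n]) (auto simp: g_def[abs_def] indicator_def)
qed

text \<open>A Lebesgue measurable function is an almost everywhere limit of continuous ones. The
  sharp window stays a separate factor, so the other factor remains continuous and can be sampled on
  a grid.\<close>

lemma approx_continuous:
  assumes f: "L12 f" and r: "c * N1 f * N2 f < Q f"
  obtains n :: nat and u where "continuous_on UNIV u" "\<And>x. 0 \<le> u x" "\<And>x. u x \<le> real n"
    "c * N1 (\<lambda>x. u x * indicator {- real n..<n} x) * N2 (\<lambda>x. u x * indicator {- real n..<n} x)
      < Q (\<lambda>x. u x * indicator {- real n..<n} x)"
proof (rule approx_bounded[OF f r])
  fix n :: nat and g
  assume [measurable]: "g \<in> borel_measurable borel" and g: "\<And>x. 0 \<le> g x"
    "\<And>x. g x \<le> real n * indicator {- real n..<n} x" and rg: "c * N1 g * N2 g < Q g"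
  have "g \<in> borel_measurable lebesgue" by (simp add: measurable_completion)
  then have "g measurable_on UNIV" by (simp add: lebesgue_measurable_imp_measurable_on)
  then obtain N v where N: "negligible N" and v: "\<And>k. continuous_on UNIV (v k)"
    and lim: "\<And>x. x \<notin> N \<Longrightarrow> (\<lambda>k. v k x) \<longlonglongrightarrow> g x"
    unfolding measurable_on_def by auto
  have [measurable]: "v k \<in> borel_measurable borel" for k
    by (rule borel_measurable_continuous_onI[OF v])
  \<comment> \<open>Clamping supplies the common majorant and does not disturb the limit, as
    \<open>g\<close> already takes values between 0 and \<open>n\<close>.\<close>
  define u where "u k x = max 0 (min (v k x) n)" for k x
  have "N \<in> null_sets lebesgue" using N by (simp add: negligible_iff_null_sets)
  then have "AE x in lebesgue. x \<notin> N" by (rule AE_not_in)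
  then have aeN: "AE x in lborel. x \<notin> N" by (simp add: AE_completion_iff)
  have "AE x in lborel. (\<lambda>k. u k x * indicator {- real n..<n} x) \<longlonglongrightarrow> g x"
    using aeN
  proof eventually_elim
    case (elim x)
    have "(\<lambda>k. u k x * indicator {- real n..<n} x) \<longlonglongrightarrow> max 0 (min (g x) n) * indicator {- real n..<n} x"
      unfolding u_def by (intro tendsto_intros lim elim)
    also have "max 0 (min (g x) n) * indicator {- real n..<n} x = g x"
      using g[of x] by (auto simp: indicator_def)
    finally show ?case .
  qed
  then have "\<forall>\<^sub>F k in sequentially. c * N1 (\<lambda>x. u k x * indicator {- real n..<n} x) * N2 (\<lambda>x. u k x * indicator {- real n..<n} x)
      < Q (\<lambda>x. u k x * indicator {- real n..<n} x)"
    by (intro ratio_open[OF L12_indicator[of "real n" "- real n" "real n"] _ _ _ _ rg])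
      (auto simp: u_def[abs_def] indicator_def)
  then obtain k where "c * N1 (\<lambda>x. u k x * indicator {- real n..<n} x) * N2 (\<lambda>x. u k x * indicator {- real n..<n} x)
      < Q (\<lambda>x. u k x * indicator {- real n..<n} x)" by (auto simp: eventually_sequentially)
  then show thesis
    by (intro that[of "u k" n]) (auto simp: u_def[abs_def] intro!: continuous_intros v)
qed

lemma approx_step:
  assumes f: "L12 f" and r: "c * N1 f * N2 f < Q f" and \<delta>: "0 < \<delta>"
  obtains h a N where "0 < h" "h < \<delta>" "\<And>i. 0 \<le> a i" "\<And>i. i \<notin> {-N..N} \<Longrightarrow> a i = 0"
    "c * N1 (\<lambda>x. a \<lfloor>x / h\<rfloor>) * N2 (\<lambda>x. a \<lfloor>x / h\<rfloor>) < Q (\<lambda>x. a \<lfloor>x / h\<rfloor>)"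
proof -
  obtain n :: nat and u where u: "continuous_on UNIV u" "\<And>x. 0 \<le> u x" "\<And>x. u x \<le> real n"
    and ru: "c * N1 (\<lambda>x. u x * indicator {- real n..<n} x) * N2 (\<lambda>x. u x * indicator {- real n..<n} x)
      < Q (\<lambda>x. u x * indicator {- real n..<n} x)"
    by (rule approx_continuous[OF f r]) blast
  have [measurable]: "u \<in> borel_measurable borel" by (rule borel_measurable_continuous_onI[OF u(1)])
  \<comment> \<open>With this mesh every integer is a grid point, so cutting to the window commutes
    with sampling at the left end points of the cells; that is the content of
    \<open>cell\<close>.\<close>
  define h where "h j = 1 / real (Suc j)" for j
  define a where "a j i = u (of_int i * h j) * indicator {- real n..<n} (of_int i * h j)" for j i
  have h: "0 < h j" for j by (simp add: h_def)
  have hlim: "h \<longlonglongrightarrow> 0" unfolding h_def by (rule LIMSEQ_Suc[OF lim_1_over_n])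
  have cell: "of_int \<lfloor>x / h j\<rfloor> * h j \<in> {- real n..<n} \<longleftrightarrow> x \<in> {- real n..<n}" for x j
  proof -
    have "- real n \<le> of_int \<lfloor>x / h j\<rfloor> * h j \<longleftrightarrow> - int (n * Suc j) \<le> \<lfloor>x / h j\<rfloor>"
    proof -
      have "- real n \<le> of_int \<lfloor>x / h j\<rfloor> * h j \<longleftrightarrow> - real n * Suc j \<le> of_int \<lfloor>x / h j\<rfloor>"
        by (simp add: h_def pos_le_divide_eq)
      also have "- real n * Suc j = of_int (- int (n * Suc j))" by (simp add: algebra_simps)
      finally show ?thesis by (simp only: of_int_le_iff)
    qed
    also have "\<dots> \<longleftrightarrow> (- real n) * Suc j \<le> x * Suc j"
      by (simp add: le_floor_iff h_def algebra_simps)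
    also have "\<dots> \<longleftrightarrow> - real n \<le> x" by (rule mult_le_cancel_right_pos) simp
    finally have 1: "- real n \<le> of_int \<lfloor>x / h j\<rfloor> * h j \<longleftrightarrow> - real n \<le> x" .
    have "of_int \<lfloor>x / h j\<rfloor> * h j < real n \<longleftrightarrow> \<lfloor>x / h j\<rfloor> < int (n * Suc j)"
    proof -
      have "of_int \<lfloor>x / h j\<rfloor> * h j < real n \<longleftrightarrow> of_int \<lfloor>x / h j\<rfloor> < real n * Suc j"
        by (simp add: h_def field_simps)
      also have "real n * Suc j = of_int (int (n * Suc j))" by (simp add: algebra_simps)
      finally show ?thesis by (simp only: of_int_less_iff)
    qed
    also have "\<dots> \<longleftrightarrow> x * Suc j < real n * Suc j"
      by (simp add: floor_less_iff h_def algebra_simps)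
    also have "\<dots> \<longleftrightarrow> x < real n" by (rule mult_less_cancel_right_pos) simp
    finally show ?thesis using 1 by simp
  qed
  have a: "a j \<lfloor>x / h j\<rfloor> = u (of_int \<lfloor>x / h j\<rfloor> * h j) * indicator {- real n..<n} x" for j x
    using cell[of x j] by (simp add: a_def indicator_def)
  have grid: "(\<lambda>j. of_int \<lfloor>x / h j\<rfloor> * h j) \<longlonglongrightarrow> x" for x
  proof (rule tendsto_sandwich)
    show "\<forall>\<^sub>F j in sequentially. x - h j \<le> of_int \<lfloor>x / h j\<rfloor> * h j"
    proof (intro always_eventually allI)
      fix j
      have "x / h j - 1 \<le> of_int \<lfloor>x / h j\<rfloor>" by linarith
      from mult_right_mono[OF this less_imp_le[OF h[of j]]] show "x - h j \<le> of_int \<lfloor>x / h j\<rfloor> * h j"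
        using h[of j] by (simp add: algebra_simps)
    qed
    show "\<forall>\<^sub>F j in sequentially. of_int \<lfloor>x / h j\<rfloor> * h j \<le> x"
    proof (intro always_eventually allI)
      fix j
      have "of_int \<lfloor>x / h j\<rfloor> \<le> x / h j" by linarith
      from mult_right_mono[OF this less_imp_le[OF h[of j]]] show "of_int \<lfloor>x / h j\<rfloor> * h j \<le> x"
        using h[of j] by (simp add: algebra_simps)
    qed
    show "(\<lambda>j. x - h j) \<longlonglongrightarrow> x" using tendsto_diff[OF tendsto_const hlim, of x] by simp
  qed simp
  have alim: "(\<lambda>j. a j \<lfloor>x / h j\<rfloor>) \<longlonglongrightarrow> u x * indicator {- real n..<n} x" for x
    unfolding a
    by (intro tendsto_intros isCont_tendsto_compose[OF _ grid])
      (use u(1) in \<open>simp add: continuous_on_eq_continuous_at\<close>)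
  have ev: "\<forall>\<^sub>F j in sequentially. c * N1 (\<lambda>x. a j \<lfloor>x / h j\<rfloor>) * N2 (\<lambda>x. a j \<lfloor>x / h j\<rfloor>) < Q (\<lambda>x. a j \<lfloor>x / h j\<rfloor>)"
  proof (rule ratio_open[OF L12_indicator[of "real n" "- real n" "real n"] _ _ _ _ ru])
    show "\<bar>a j \<lfloor>x / h j\<rfloor>\<bar> \<le> \<bar>real n * indicator {- real n..real n} x\<bar>" for j x
      unfolding a using u(2,3) by (auto simp: indicator_def)
  qed (use alim in \<open>auto simp: a\<close>)
  have "\<forall>\<^sub>F j in sequentially. h j < \<delta>" using hlim \<delta> by (rule order_tendstoD)
  with ev have "\<forall>\<^sub>F j in sequentially. h j < \<delta> \<and> c * N1 (\<lambda>x. a j \<lfloor>x / h j\<rfloor>) * N2 (\<lambda>x. a j \<lfloor>x / h j\<rfloor>) < Q (\<lambda>x. a j \<lfloor>x / h j\<rfloor>)"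
    by eventually_elim auto
  then obtain j where j: "h j < \<delta>" "c * N1 (\<lambda>x. a j \<lfloor>x / h j\<rfloor>) * N2 (\<lambda>x. a j \<lfloor>x / h j\<rfloor>) < Q (\<lambda>x. a j \<lfloor>x / h j\<rfloor>)"
    by (auto simp: eventually_sequentially)
  show thesis
  proof (rule that[where a = "a j" and N = "int (n * Suc j)", OF h j(1) _ _ j(2)])
    show "0 \<le> a j i" for i using u(2) by (simp add: a_def)
    show "a j i = 0" if "i \<notin> {- int (n * Suc j).. int (n * Suc j)}" for i
    proof -
      have "of_int i * h j \<notin> {- real n..<n}"
      proof
        assume "of_int i * h j \<in> {- real n..<n}"
        then have "- real n * Suc j \<le> of_int i" "of_int i < real n * Suc j"
          by (auto simp: h_def field_simps)
        moreover have "- real n * Suc j = of_int (- int (n * Suc j))"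
          "real n * Suc j = of_int (int (n * Suc j))" by (simp_all add: algebra_simps)
        ultimately have "- int (n * Suc j) \<le> i" "i < int (n * Suc j)"
          by (simp_all only: of_int_le_iff of_int_less_iff)
        then show False using that by auto
      qed
      then show ?thesis by (simp add: a_def)
    qed
  qed
qed

section \<open>The matrix of the form on a grid: symmetric, Toeplitz and decreasing away from the
  diagonal\<close>

definition cells :: "real \<Rightarrow> int \<Rightarrow> int \<Rightarrow> real" where
  "cells h i j = (\<integral>p. indicator {real_of_int i * h..<(real_of_int i + 1) * h} (fst p) * indicator {real_of_int j * h..<(real_of_int j + 1) * h} (snd p)
      * w (fst p - snd p) \<partial>(lborel \<Otimes>\<^sub>M lborel))"

lemma integrable_cell: "integrable lborel (indicator {real_of_int i * h..<(real_of_int i + 1) * h} :: real \<Rightarrow> real)"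
  by (cases "real_of_int i * h \<le> (real_of_int i + 1) * h") auto

lemma cells_swap: "cells h i j = cells h j i"
proof -
  let ?I = "\<lambda>i. indicator {real_of_int i * h..<(real_of_int i + 1) * h} :: real \<Rightarrow> real"
  have "cells h j i = (\<integral>(x, y). ?I j (fst (y, x)) * ?I i (snd (y, x)) * w (fst (y, x) - snd (y, x)) \<partial>(lborel \<Otimes>\<^sub>M lborel))"
    unfolding cells_def
    by (rule lborel_pair.integral_product_swap[symmetric]) measurable
  also have "\<dots> = cells h i j" unfolding cells_def by (simp add: split_beta' w_swap mult.commute)
  finally show ?thesis by simp
qed

lemma floor_cell: "0 < h \<Longrightarrow> \<lfloor>x / h\<rfloor> = i \<longleftrightarrow> x \<in> {real_of_int i * h..<(real_of_int i + 1) * h}"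
  by (simp add: floor_eq_iff field_simps)

lemma step_eq_sum:
  assumes h: "0 < h" and a: "\<And>i. i \<notin> {-N..N} \<Longrightarrow> a i = (0::real)"
  shows "a \<lfloor>x / h\<rfloor> = (\<Sum>i\<in>{-N..N}. a i * indicator {real_of_int i * h..<(real_of_int i + 1) * h} x)"
proof -
  have ind: "indicator {real_of_int i * h..<(real_of_int i + 1) * h} x = (if i = \<lfloor>x / h\<rfloor> then 1 else 0 :: real)" for i
    using floor_cell[OF h, of x i] by (auto simp: indicator_def)
  have "(\<Sum>i\<in>{-N..N}. a i * indicator {real_of_int i * h..<(real_of_int i + 1) * h} x) =
      (\<Sum>i\<in>{-N..N}. if i = \<lfloor>x / h\<rfloor> then a i else 0)"
    by (rule sum.cong) (auto simp: ind)
  also have "\<dots> = a \<lfloor>x / h\<rfloor>" using a by (simp add: sum.delta')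
  finally show ?thesis by simp
qed

lemma Q_step:
  assumes h: "0 < h" and a: "\<And>i. i \<notin> {-N..N} \<Longrightarrow> a i = (0::real)"
  shows "Q (\<lambda>x. a \<lfloor>x / h\<rfloor>) = (\<Sum>i\<in>{-N..N}. \<Sum>j\<in>{-N..N}. a i * a j * cells h i j)"
proof -
  let ?I = "\<lambda>i. indicator {real_of_int i * h..<(real_of_int i + 1) * h} :: real \<Rightarrow> real"
  have s: "a \<lfloor>x / h\<rfloor> = (\<Sum>i\<in>{-N..N}. a i * ?I i x)" for x
    by (rule step_eq_sum[OF h a])
  have e: "a \<lfloor>x / h\<rfloor> * a \<lfloor>y / h\<rfloor> * z = (\<Sum>i\<in>{-N..N}. \<Sum>j\<in>{-N..N}. a i * a j * (?I i x * ?I j y * z))" for x y z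
  proof -
    have "a \<lfloor>x / h\<rfloor> * a \<lfloor>y / h\<rfloor> = (\<Sum>i\<in>{-N..N}. \<Sum>j\<in>{-N..N}. a i * ?I i x * (a j * ?I j y))"
      by (simp only: s sum_product)
    then show ?thesis by (simp only: sum_distrib_right) (simp only: mult_ac)
  qed
  have int: "integrable (lborel \<Otimes>\<^sub>M lborel) (\<lambda>p. ?I i (fst p) * ?I j (snd p) * w (fst p - snd p))" for i j
    by (rule integrable_form[OF integrable_cell integrable_cell])
  show ?thesis unfolding Q_def e cells_def
    by (simp add: Bochner_Integration.integral_sum int)
qed

lemma int_step:
  assumes h: "0 < h" and a: "\<And>i. i \<notin> {-N..N} \<Longrightarrow> a i = (0::real)"
  shows "integrable lborel (\<lambda>x. a \<lfloor>x / h\<rfloor>)" "(\<integral>x. a \<lfloor>x / h\<rfloor> \<partial>lborel) = h * (\<Sum>i\<in>{-N..N}. a i)"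
proof -
  let ?I = "\<lambda>i. indicator {real_of_int i * h..<(real_of_int i + 1) * h} :: real \<Rightarrow> real"
  have s: "a \<lfloor>x / h\<rfloor> = (\<Sum>i\<in>{-N..N}. a i * ?I i x)" for x
    by (rule step_eq_sum[OF h a])
  have "(\<integral>x. ?I i x \<partial>lborel) = h" for i
  proof -
    have "real_of_int i * h \<le> (real_of_int i + 1) * h" using h by (intro mult_right_mono) auto
    then show ?thesis by (simp add: distrib_right)
  qed
  then show "(\<integral>x. a \<lfloor>x / h\<rfloor> \<partial>lborel) = h * (\<Sum>i\<in>{-N..N}. a i)"
    unfolding s sum_distrib_left
    by (subst Bochner_Integration.integral_sum) (auto intro!: sum.cong integrable_mult_right integrable_cell)
  show "integrable lborel (\<lambda>x. a \<lfloor>x / h\<rfloor>)"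
    unfolding s by (intro Bochner_Integration.integrable_sum integrable_mult_right integrable_cell)
qed

lemma L12_step:
  assumes h: "0 < h" and a: "\<And>i. i \<notin> {-N..N} \<Longrightarrow> a i = (0::real)"
  shows "L12 (\<lambda>x. a \<lfloor>x / h\<rfloor>)"
  using int_step(1)[OF h, where a = a and N = N] int_step(1)[OF h, where a = "\<lambda>i. (a i)\<^sup>2" and N = N] a
  by (simp add: L12_def)

text \<open>The inner interval is closed at the cost of a single point, so that the reflection of a
  cell in \<open>cells_eq\<close> maps it to a closed interval again.\<close>

lemma cells_iterated:
  "cells h i j = (\<integral>x. indicator {real_of_int i * h..<(real_of_int i + 1) * h} x * (\<integral>y. indicator {real_of_int j * h..(real_of_int j + 1) * h} y * w (x - y) \<partial>lborel) \<partial>lborel)"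
proof -
  have "cells h i j = (\<integral>x. (\<integral>y. indicator {real_of_int i * h..<(real_of_int i + 1) * h} x * indicator {real_of_int j * h..<(real_of_int j + 1) * h} y * w (x - y) \<partial>lborel) \<partial>lborel)"
    unfolding cells_def
    using lborel_pair.integral_fst'[OF integrable_form[OF integrable_cell[of i h] integrable_cell[of j h]]] by simp
  also have "\<dots> = (\<integral>x. indicator {real_of_int i * h..<(real_of_int i + 1) * h} x * (\<integral>y. indicator {real_of_int j * h..<(real_of_int j + 1) * h} y * w (x - y) \<partial>lborel) \<partial>lborel)"
    by (simp add: mult.assoc)
  finally have 1: "cells h i j = \<dots>" .
  have "(\<integral>y. indicator {real_of_int j * h..<(real_of_int j + 1) * h} y * w (x - y) \<partial>lborel) = (\<integral>y. indicator {real_of_int j * h..(real_of_int j + 1) * h} y * w (x - y) \<partial>lborel)" for x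
    by (rule integral_cong_AE)
      (use AE_lborel_singleton[of "(real_of_int j + 1) * h"] in \<open>auto elim!: eventually_mono simp: indicator_def\<close>)
  with 1 show ?thesis by (simp only:)
qed

text \<open>The second form reflects \<open>y\<close> within its cell; comparing it with the first one turns the
  monotonicity of \<open>cells\<close> into the pointwise inequality \<open>w (x + y + k h) \<le> w (x - y + k h)\<close>.\<close>

lemma cells_eq:
  "cells h i j = (\<integral>x. indicator {0..<h} x * (\<integral>y. indicator {0..h} y * w (x - y + of_int (i - j) * h) \<partial>lborel) \<partial>lborel)"
  "cells h i j = (\<integral>x. indicator {0..<h} x * (\<integral>y. indicator {0..h} y * w (x + y + of_int (i - j - 1) * h) \<partial>lborel) \<partial>lborel)"
proof -
  have "cells h i j = (\<integral>x. indicator {real_of_int i * h..<(real_of_int i + 1) * h} (i * h + 1 * x) * (\<integral>y. indicator {real_of_int j * h..(real_of_int j + 1) * h} y * w (i * h + 1 * x - y) \<partial>lborel) \<partial>lborel)"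
    unfolding cells_iterated by (subst lborel_integral_real_affine[of 1 _ "i * h"]) simp_all
  also have "\<dots> = (\<integral>x. indicator {0..<h} x * (\<integral>y. indicator {real_of_int j * h..(real_of_int j + 1) * h} y * w (i * h + x - y) \<partial>lborel) \<partial>lborel)"
    by (intro Bochner_Integration.integral_cong) (auto simp: indicator_def algebra_simps)
  finally have 0: "cells h i j = \<dots>" .
  have "(\<integral>y. indicator {real_of_int j * h..(real_of_int j + 1) * h} y * w (i * h + x - y) \<partial>lborel) = (\<integral>y. indicator {0..h} y * w (x - y + of_int (i - j) * h) \<partial>lborel)" for x
    by (subst lborel_integral_real_affine[of 1 _ "j * h"])
      (auto intro!: Bochner_Integration.integral_cong simp: indicator_def algebra_simps)
  with 0 show "cells h i j = (\<integral>x. indicator {0..<h} x * (\<integral>y. indicator {0..h} y * w (x - y + of_int (i - j) * h) \<partial>lborel) \<partial>lborel)"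
    by simp
  have "(\<integral>y. indicator {real_of_int j * h..(real_of_int j + 1) * h} y * w (i * h + x - y) \<partial>lborel) = (\<integral>y. indicator {0..h} y * w (x + y + of_int (i - j - 1) * h) \<partial>lborel)" for x
    by (subst lborel_integral_real_affine[of "-1" _ "(real_of_int j + 1) * h"])
      (auto intro!: Bochner_Integration.integral_cong simp: indicator_def algebra_simps)
  with 0 show "cells h i j = (\<integral>x. indicator {0..<h} x * (\<integral>y. indicator {0..h} y * w (x + y + of_int (i - j - 1) * h) \<partial>lborel) \<partial>lborel)"
    by simp
qed

lemma cells_diff: "cells h i j = cells h (i - j) 0"
  using cells_eq(1)[of h i j] cells_eq(1)[of h "i - j" 0] by simp

lemma cells_Suc:
  assumes h: "0 < h" and k: "0 \<le> k"
  shows "cells h (k + 1) 0 \<le> cells h k 0"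
proof -
  have int: "integrable lborel (\<lambda>y. indicator {0..h} y * w (x - y + c))" for x c
    using integrable_mult_indicator[OF _ w_shift(1)[of "x + c"], of "{0..h}"] by (simp add: algebra_simps)
  have int': "integrable lborel (\<lambda>y. indicator {0..h} y * w (x + y + c))" for x c
    using integrable_mult_indicator[OF _ lborel_integrable_real_affine[OF int_w, of 1 "x + c"], of "{0..h}"]
    by (simp add: algebra_simps)
  have hi: "integrable lborel (\<lambda>y. indicator {0..h} y * w 0)" "(\<integral>y. indicator {0..h} y * w 0 \<partial>lborel) = w 0 * h"
    using h by simp_all
  have b: "(\<integral>y. indicator {0..h} y * w (x + y + c) \<partial>lborel) \<le> w 0 * h"
    "(\<integral>y. indicator {0..h} y * w (x - y + c) \<partial>lborel) \<le> w 0 * h" for x c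
    unfolding hi(2)[symmetric]
    by (intro integral_mono int int' hi(1) mult_left_mono w_le_0; simp)+
  have nn: "0 \<le> (\<integral>y. indicator {0..h} y * w (x + y + c) \<partial>lborel)"
    "0 \<le> (\<integral>y. indicator {0..h} y * w (x - y + c) \<partial>lborel)" for x c
    by (auto intro!: integral_nonneg_AE)
  have b': "\<bar>\<integral>y. indicator {0..h} y * w (x + y + c) \<partial>lborel\<bar> \<le> \<bar>w 0\<bar> * \<bar>h\<bar>"
    "\<bar>\<integral>y. indicator {0..h} y * w (x - y + c) \<partial>lborel\<bar> \<le> \<bar>w 0\<bar> * \<bar>h\<bar>" for x c
    using nn[of x c] b[of x c] abs_ge_self[of "w 0 * h"] unfolding abs_mult by linarith+
  have hi': "integrable lborel (\<lambda>x. indicator {0..<h} x * (w 0 * h))"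
    using h by simp
  \<comment> \<open>For \<open>i = k + 1\<close> and \<open>j = 0\<close> the shift in the second
    form is again \<open>k\<close>, so the two integrands differ only in the sign of
    \<open>y\<close>.\<close>
  show ?thesis
    unfolding cells_eq(2)[of h "k + 1"] cells_eq(1)[of h k]
  proof (rule integral_mono)
    show "integrable lborel (\<lambda>x. indicator {0..<h} x * (\<integral>y. indicator {0..h} y * w (x + y + of_int (k + 1 - 0 - 1) * h) \<partial>lborel))"
      by (rule Bochner_Integration.integrable_bound[OF hi'])
       (measurable, unfold real_norm_def, unfold abs_mult, intro AE_I2 mult_left_mono b' abs_ge_zero)
    show "integrable lborel (\<lambda>x. indicator {0..<h} x * (\<integral>y. indicator {0..h} y * w (x - y + of_int (k - 0) * h) \<partial>lborel))"
      by (rule Bochner_Integration.integrable_bound[OF hi'])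
       (measurable, unfold real_norm_def, unfold abs_mult, intro AE_I2 mult_left_mono b' abs_ge_zero)
    fix x
    show "indicator {0..<h} x * (\<integral>y. indicator {0..h} y * w (x + y + of_int (k + 1 - 0 - 1) * h) \<partial>lborel)
       \<le> indicator {0..<h} x * (\<integral>y. indicator {0..h} y * w (x - y + of_int (k - 0) * h) \<partial>lborel)"
    proof (cases "x \<in> {0..<h}")
      case True
      have kh: "0 \<le> of_int k * h" using h k by simp
      \<comment> \<open>All of \<open>x\<close>, \<open>y\<close> and \<open>k h\<close> are
        nonnegative here, whence \<open>\<bar>x - y + k h\<bar> <= x + y + k h\<close>.\<close>
      have "(\<integral>y. indicator {0..h} y * w (x + y + of_int k * h) \<partial>lborel)
        \<le> (\<integral>y. indicator {0..h} y * w (x - y + of_int k * h) \<partial>lborel)"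
        using True kh by (intro integral_mono int int') (auto simp: indicator_def intro!: w_anti)
      then show ?thesis using True by simp
    qed simp
  qed
qed

text \<open>Symmetry together with translation invariance makes the entries even in the index
  difference, so induction on \<open>cells_Suc\<close> over nonnegative indices suffices.\<close>

lemma cells_antimono:
  assumes h: "0 < h" and ij: "\<bar>i\<bar> \<le> \<bar>j\<bar>"
  shows "cells h j 0 \<le> cells h i 0"
proof -
  have even: "cells h (- k) 0 = cells h k 0" for k
    using cells_diff[of h 0 k] cells_swap[of h 0 k] by simp
  have abs: "cells h k 0 = cells h \<bar>k\<bar> 0" for k using even[of k] by (cases "0 \<le> k") auto
  have "cells h l 0 \<le> cells h k 0" if "0 \<le> k" "k \<le> l" for k l
    using that(2)
  proof (induction l rule: int_ge_induct)
    case (step l)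
    then show ?case using cells_Suc[OF h, of l] that(1) by linarith
  qed simp
  then show ?thesis using ij abs[of i] abs[of j] by simp
qed

text \<open>The rearrangement keeps the sums of absolute values and of squares, hence both norms,
  and does not lower the form, so the strict inequality survives.\<close>

lemma rearranged_step:
  assumes f: "L12 f" and r: "c * N1 f * N2 f < Q f" and \<delta>: "0 < \<delta>"
  obtains h b where "0 < h" "h < \<delta>" "\<And>i. 0 \<le> b i"
    "\<And>i. 0 \<le> i \<Longrightarrow> b (- i) \<le> b i" "\<And>i. 0 \<le> i \<Longrightarrow> b (i + 1) \<le> b (- i)"
    "L12 (\<lambda>x. b \<lfloor>x / h\<rfloor>)"
    "c * N1 (\<lambda>x. b \<lfloor>x / h\<rfloor>) * N2 (\<lambda>x. b \<lfloor>x / h\<rfloor>) < Q (\<lambda>x. b \<lfloor>x / h\<rfloor>)"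
proof -
  obtain h a N where h: "0 < h" "h < \<delta>" and a: "\<And>i. 0 \<le> a i" "\<And>i. i \<notin> {-N..N} \<Longrightarrow> a i = 0"
    and ra: "c * N1 (\<lambda>x. a \<lfloor>x / h\<rfloor>) * N2 (\<lambda>x. a \<lfloor>x / h\<rfloor>) < Q (\<lambda>x. a \<lfloor>x / h\<rfloor>)"
    by (rule approx_step[OF f r \<delta>]) blast
  show thesis
  proof (rule discrete_riesz[where W = "\<lambda>k. cells h k 0" and a = a and N = N])
    show "cells h j 0 \<le> cells h i 0" if "\<bar>i\<bar> \<le> \<bar>j\<bar>" for i j
      using cells_antimono[OF h(1) that] .
  next
    fix b :: "int \<Rightarrow> real"
    assume b: "\<And>i. 0 \<le> b i" "\<And>i. i \<notin> {-N..N} \<Longrightarrow> b i = 0"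
      "\<And>g. (\<Sum>i\<in>{-N..N}. g (b i)) = (\<Sum>i\<in>{-N..N}. g (a i) :: real)"
      "(\<Sum>i\<in>{-N..N}. \<Sum>j\<in>{-N..N}. a i * a j * cells h (i - j) 0)
        \<le> (\<Sum>i\<in>{-N..N}. \<Sum>j\<in>{-N..N}. b i * b j * cells h (i - j) 0)"
      "\<And>i. 0 \<le> i \<Longrightarrow> b (- i) \<le> b i" "\<And>i. 0 \<le> i \<Longrightarrow> b (i + 1) \<le> b (- i)"
    have "Q (\<lambda>x. a \<lfloor>x / h\<rfloor>) = (\<Sum>i\<in>{-N..N}. \<Sum>j\<in>{-N..N}. a i * a j * cells h (i - j) 0)"
      unfolding cells_diff[symmetric] by (rule Q_step[OF h(1) a(2)])
    moreover have "Q (\<lambda>x. b \<lfloor>x / h\<rfloor>) = (\<Sum>i\<in>{-N..N}. \<Sum>j\<in>{-N..N}. b i * b j * cells h (i - j) 0)"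
      unfolding cells_diff[symmetric] by (rule Q_step[OF h(1) b(2)])
    moreover have "N1 (\<lambda>x. b \<lfloor>x / h\<rfloor>) = N1 (\<lambda>x. a \<lfloor>x / h\<rfloor>)"
      using int_step(2)[OF h(1), of N "\<lambda>i. \<bar>a i\<bar>"] int_step(2)[OF h(1), of N "\<lambda>i. \<bar>b i\<bar>"] a(2) b(2) b(3)[of abs]
      by simp
    moreover have "N2 (\<lambda>x. b \<lfloor>x / h\<rfloor>) = N2 (\<lambda>x. a \<lfloor>x / h\<rfloor>)"
      using int_step(2)[OF h(1), of N "\<lambda>i. (a i)\<^sup>2"] int_step(2)[OF h(1), of N "\<lambda>i. (b i)\<^sup>2"] a(2) b(2) b(3)[of "\<lambda>x. x\<^sup>2"]
      by simp
    ultimately show thesis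
      using that[OF h b(1) b(5) b(6) L12_step[OF h(1) b(2)]] ra b(4) by simp
  qed (use a in auto)
qed

end

section \<open>Compactness of rearranged step functions\<close>

lemma fatou_real:
  fixes u :: "nat \<Rightarrow> real \<Rightarrow> real"
  assumes int: "\<And>k. integrable lborel (u k)" and [measurable]: "v \<in> borel_measurable borel"
    and nn: "\<And>k x. 0 \<le> u k x" "\<And>x. 0 \<le> v x"
    and lim: "AE x in lborel. (\<lambda>k. u k x) \<longlonglongrightarrow> v x"
    and \<mu>: "(\<lambda>k. \<integral>x. u k x \<partial>lborel) \<longlonglongrightarrow> \<mu>"
  shows "integrable lborel v" "(\<integral>x. v x \<partial>lborel) \<le> \<mu>"
proof -
  have [measurable]: "u k \<in> borel_measurable borel" for k using int[of k] by auto
  have \<mu>0: "0 \<le> \<mu>" by (rule LIMSEQ_le_const[OF \<mu>]) (auto intro!: integral_nonneg_AE nn)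
  have "(\<integral>\<^sup>+x. ennreal (v x) \<partial>lborel) = (\<integral>\<^sup>+x. liminf (\<lambda>k. ennreal (u k x)) \<partial>lborel)"
  proof (rule nn_integral_cong_AE)
    show "AE x in lborel. ennreal (v x) = liminf (\<lambda>k. ennreal (u k x))"
      using lim
    proof eventually_elim
      case (elim x)
      then have "(\<lambda>k. ennreal (u k x)) \<longlonglongrightarrow> ennreal (v x)" by (rule tendsto_ennrealI)
      then show ?case by (intro lim_imp_Liminf[symmetric]) auto
    qed
  qed
  also have "\<dots> \<le> liminf (\<lambda>k. \<integral>\<^sup>+x. ennreal (u k x) \<partial>lborel)"
    by (rule nn_integral_liminf) measurable
  also have "\<dots> = liminf (\<lambda>k. ennreal (\<integral>x. u k x \<partial>lborel))"
    using int nn by (simp add: nn_integral_eq_integral)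
  also have "\<dots> = ennreal \<mu>"
    by (intro lim_imp_Liminf tendsto_ennrealI \<mu>) simp
  finally have le: "(\<integral>\<^sup>+x. ennreal (v x) \<partial>lborel) \<le> ennreal \<mu>" .
  then show 1: "integrable lborel v" using nn
    by (intro integrableI_nonneg) (auto intro: le_less_trans)
  show "(\<integral>x. v x \<partial>lborel) \<le> \<mu>"
    using le nn_integral_eq_integral[OF 1] nn \<mu>0 by (simp add: ennreal_le_iff)
qed

text \<open>For \<open>u\<close> decreasing on the positive half-line and \<open>c = u r\<close>
  this turns an integral into the pointwise decay \<open>r * u r <= \<integral>u\<close>. It is
  applied to the kernel, to the profiles and to their squares.\<close>

lemma decay_bound:
  fixes u :: "real \<Rightarrow> real"
  assumes "integrable lborel u" "\<And>x. 0 \<le> u x" "0 < r" "\<And>x. 0 < x \<Longrightarrow> x \<le> r \<Longrightarrow> c \<le> u x"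
  shows "r * c \<le> (\<integral>x. u x \<partial>lborel)"
proof -
  have "(\<integral>x. c * indicator {0<..r} x \<partial>lborel) \<le> (\<integral>x. u x \<partial>lborel)"
  proof (rule integral_mono)
    show "integrable lborel (\<lambda>x. c * indicator {0<..r} x)" using assms(3) by simp
    show "c * indicator {0<..r} x \<le> u x" for x using assms(2,4)[of x] by (simp add: indicator_def)
  qed (rule assms(1))
  then show ?thesis using assms(3) by (simp add: mult.commute)
qed

section \<open>Integrable powers for the majorants near 0 and at infinity\<close>

lemma integrable_lborel_nonneg:
  fixes u :: "real \<Rightarrow> real"
  assumes "u integrable_on S" "\<And>x. x \<in> S \<Longrightarrow> 0 \<le> u x"
    and "(\<lambda>x. indicator S x * u x) \<in> borel_measurable borel"
  shows "integrable lborel (\<lambda>x. indicator S x * u x)"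
proof -
  have "integrable lebesgue (\<lambda>x. indicator S x * u x)"
    using nonnegative_absolutely_integrable_1[OF assms(1,2)] by (simp add: set_integrable_def)
  then show ?thesis using assms(3) by (simp add: integrable_completion)
qed

lemma integrable_reflect:
  assumes "integrable lborel (u :: real \<Rightarrow> real)"
  shows "integrable lborel (\<lambda>x. u (- x))"
  using lborel_integrable_real_affine[OF assms, of "-1" 0] by simp

lemma integrable_singular_part:
  "integrable lborel (\<lambda>x::real. indicator {-1..1} x * \<bar>x\<bar> powr (-1/2))"
proof -
  have "integrable lborel (\<lambda>x::real. indicator {0..1} x * x powr (-1/2))"
    by (rule integrable_lborel_nonneg) (auto intro!: integrable_on_powr_from_0)
  from Bochner_Integration.integrable_add[OF this integrable_reflect[OF this]]
  show ?thesis
    by (rule Bochner_Integration.integrable_bound) (auto simp: indicator_def)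
qed

lemma integrable_tail_part:
  "integrable lborel (\<lambda>x::real. indicator (- {-1..1}) x * \<bar>x\<bar> powr (-2))"
proof -
  have "integrable lborel (\<lambda>x::real. indicator {1..} x * x powr (-2))"
    by (rule integrable_lborel_nonneg)
      (use has_integral_powr_to_inf[of "-2" 1] in \<open>auto simp: integrable_on_def\<close>)
  from Bochner_Integration.integrable_add[OF this integrable_reflect[OF this]]
  show ?thesis
    by (rule Bochner_Integration.integrable_bound) (auto simp: indicator_def)
qed

text \<open>Profiles with values \<open>b\<^sub>0 \<ge> b\<^sub>1 \<ge> b\<^sub>-\<^sub>1 \<ge> b\<^sub>2 \<ge> \<dots>\<close> on the cells of the grid.\<close>

locale step_profile =
  fixes b :: "int \<Rightarrow> real" and h :: real
  assumes h: "0 < h" and b_nonneg: "\<And>i. 0 \<le> b i"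
    and b_neg: "\<And>i. 0 \<le> i \<Longrightarrow> b (- i) \<le> b i" and b_next: "\<And>i. 0 \<le> i \<Longrightarrow> b (i + 1) \<le> b (- i)"
begin

lemma b_anti: "0 \<le> i \<Longrightarrow> i \<le> j \<Longrightarrow> b j \<le> b i"
proof (rotate_tac 1, induction j rule: int_ge_induct)
  case (step j)
  then show ?case using b_neg[of j] b_next[of j] by simp
qed simp

lemma step_anti: "0 \<le> x \<Longrightarrow> x \<le> y \<Longrightarrow> b \<lfloor>y / h\<rfloor> \<le> b \<lfloor>x / h\<rfloor>"
  using h by (intro b_anti floor_mono divide_right_mono) auto

text \<open>The profile is not even, but the value at \<open>- y\<close> is caught between those at
  \<open>y\<close> and two cells further out. As the mesh tends to 0 this forces the limit to be
  even.\<close>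

lemma step_reflect:
  assumes "0 \<le> y"
  shows "b \<lfloor>(y + 2 * h) / h\<rfloor> \<le> b \<lfloor>- y / h\<rfloor>" "b \<lfloor>- y / h\<rfloor> \<le> b \<lfloor>y / h\<rfloor>"
proof -
  define i where "i = \<lfloor>y / h\<rfloor>"
  have i: "0 \<le> i" using assms h by (simp add: i_def)
  have 2: "\<lfloor>(y + 2 * h) / h\<rfloor> = i + 2" using h by (simp add: i_def add_divide_distrib)
  have "\<lfloor>- y / h\<rfloor> = - i \<or> \<lfloor>- y / h\<rfloor> = - (i + 1)"
    unfolding i_def by linarith
  then show "b \<lfloor>(y + 2 * h) / h\<rfloor> \<le> b \<lfloor>- y / h\<rfloor>" "b \<lfloor>- y / h\<rfloor> \<le> b \<lfloor>y / h\<rfloor>"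
    unfolding 2 i_def[symmetric]
    using i b_neg[of i] b_next[of i] b_neg[of "i + 1"] b_next[of "i + 1"] b_anti[of i "i + 1"] b_anti[of "i + 1" "i + 2"]
    by (auto simp: add.assoc)
qed

text \<open>Helly's theorem needs nondecreasing, right-continuous, uniformly bounded functions,
  whereas the profiles decrease and have no common bound. The map \<open>t\<close> to
  \<open>1 / (1 + t)\<close> reverses the order and compresses the range; it is inverted in
  \<open>step_eq_G\<close>.\<close>

definition G :: "real \<Rightarrow> real" where
  "G x = (if x < 0 then 0 else 1 / (1 + b \<lfloor>x / h\<rfloor>))"

lemma G_bounds: "0 \<le> G x" "G x \<le> 1"
  using b_nonneg[of "\<lfloor>x / h\<rfloor>"] by (auto simp: G_def)

lemma G_mono: "mono G"
proof (rule monoI)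
  fix x y :: real assume xy: "x \<le> y"
  show "G x \<le> G y"
  proof (cases "x < 0")
    case False
    then have "b \<lfloor>y / h\<rfloor> \<le> b \<lfloor>x / h\<rfloor>" using xy by (intro step_anti) auto
    then show ?thesis using False xy b_nonneg[of "\<lfloor>y / h\<rfloor>"]
      by (auto simp: G_def intro!: divide_left_mono mult_pos_pos add_pos_nonneg b_nonneg)
  qed (use G_bounds in \<open>auto simp: G_def\<close>)
qed

text \<open>The cells are closed on the left, so the function is constant immediately to the right
  of every point.\<close>

lemma G_right_continuous: "continuous (at_right x) G"
proof -
  have "\<forall>\<^sub>F y in at_right x. G y = G x"
  proof (cases "x < 0")
    case True
    then show ?thesis unfolding eventually_at_right[OF True] by (intro exI[of _ 0]) (auto simp: G_def)
  next
    case False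
    let ?b = "(real_of_int \<lfloor>x / h\<rfloor> + 1) * h"
    have xb: "x < ?b"
      using h floor_correct[of "x / h"] by (simp add: field_simps)
    have "\<lfloor>y / h\<rfloor> = \<lfloor>x / h\<rfloor>" if "x < y" "y < ?b" for y
    proof (rule floor_unique)
      have "real_of_int \<lfloor>x / h\<rfloor> \<le> x / h" by linarith
      also have "\<dots> \<le> y / h" using that h by (simp add: divide_right_mono)
      finally show "real_of_int \<lfloor>x / h\<rfloor> \<le> y / h" .
      show "y / h < real_of_int \<lfloor>x / h\<rfloor> + 1" using that h by (simp add: field_simps)
    qed
    then show ?thesis unfolding eventually_at_right[OF xb] using False xb
      by (intro exI[of _ ?b]) (auto simp: G_def)
  qed
  then show ?thesis unfolding continuous_within by (rule tendsto_eventually)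
qed

lemma step_eq_G: "0 \<le> x \<Longrightarrow> b \<lfloor>x / h\<rfloor> = 1 / G x - 1"
  using b_nonneg[of "\<lfloor>x / h\<rfloor>"] by (simp add: G_def)

end

text \<open>Helly's theorem is applied to the transforms \<open>G\<close>. The bound by
  \<open>M / x\<close> keeps their limit \<open>F\<close> positive on the positive axis, so the
  transformation can be undone there; the negative axis follows by squeezing. Only countably many
  points are lost, the discontinuities of \<open>F\<close> with their reflections and 0.\<close>

lemma step_profiles_compact:
  fixes b :: "nat \<Rightarrow> int \<Rightarrow> real" and h :: "nat \<Rightarrow> real"
  assumes sp: "\<And>k. step_profile (b k) (h k)" and hlim: "h \<longlonglongrightarrow> 0"
    and bound: "\<And>k x. 0 < x \<Longrightarrow> x * b k \<lfloor>x / h k\<rfloor> \<le> M"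
  obtains s f where "strict_mono (s :: nat \<Rightarrow> nat)" "f \<in> borel_measurable borel" "\<And>x. 0 \<le> f x"
    "\<And>x. f (- x) = f x" "\<And>x y. x \<noteq> 0 \<Longrightarrow> \<bar>x\<bar> \<le> \<bar>y\<bar> \<Longrightarrow> f y \<le> (f x :: real)"
    "AE x in lborel. (\<lambda>k. b (s k) \<lfloor>x / h (s k)\<rfloor>) \<longlonglongrightarrow> f x"
proof -
  define G where "G k = step_profile.G (b k) (h k)" for k
  have "\<exists>s. strict_mono (s::nat \<Rightarrow> nat) \<and> (\<exists>F. (\<forall>x. continuous (at_right x) F) \<and> mono F \<and> (\<forall>x. \<bar>F x\<bar> \<le> 1) \<and>
    (\<forall>x. continuous (at x) F \<longrightarrow> (\<lambda>n. G (s n) x) \<longlonglongrightarrow> F x))"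
    by (rule Helly_selection)
      (use step_profile.G_bounds[OF sp] in
        \<open>auto simp: G_def step_profile.G_mono[OF sp] step_profile.G_right_continuous[OF sp]\<close>)
  then obtain s F where s: "strict_mono (s::nat \<Rightarrow> nat)" and F: "\<And>x. continuous (at_right x) F" "mono F"
    "\<And>x. \<bar>F x\<bar> \<le> 1" and lim: "\<And>x. continuous (at x) F \<Longrightarrow> (\<lambda>n. G (s n) x) \<longlonglongrightarrow> F x"
    by auto
  define D where "D = {x. \<not> continuous (at x) F}"
  have D: "countable D" unfolding D_def using mono_ctble_discont[OF F(2)] by simp
  have dense: "\<exists>z. x < z \<and> z < y \<and> z \<notin> D" if "x < y" for x y
    using open_minus_countable[OF D, of "{x<..<y}"] that by auto
  have M0: "0 \<le> M" using bound[of 1 0] step_profile.b_nonneg[OF sp[of 0], of "\<lfloor>1 / h 0\<rfloor>"] by simp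
  have Fpos: "0 < F x" if x: "0 < x" for x
  proof -
    obtain z where z: "0 < z" "z < x" "z \<notin> D" using dense[OF x] by auto
    have "1 / (1 + M / z) \<le> F z"
    proof (rule LIMSEQ_le_const)
      show "(\<lambda>n. G (s n) z) \<longlonglongrightarrow> F z" using lim z(3) by (simp add: D_def)
      have "1 / (1 + M / z) \<le> G k z" for k
      proof -
        have "b k \<lfloor>z / h k\<rfloor> \<le> M / z" using bound[OF z(1), of k] z(1) by (simp add: field_simps)
        then show ?thesis using z(1) M0 step_profile.b_nonneg[OF sp[of k], of "\<lfloor>z / h k\<rfloor>"]
          by (auto simp: G_def step_profile.G_def[OF sp] intro!: divide_left_mono mult_pos_pos add_pos_nonneg)
      qed
      then show "\<exists>N. \<forall>n\<ge>N. 1 / (1 + M / z) \<le> G (s n) z" by auto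
    qed
    moreover have "0 < 1 / (1 + M / z)" using z M0 by (simp add: add_pos_nonneg)
    moreover have "F z \<le> F x" using F(2) z by (auto simp: mono_def)
    ultimately show ?thesis by linarith
  qed
  \<comment> \<open>At 0 the limit \<open>F\<close> may vanish, since the profiles may blow up
    there. The value 0 keeps \<open>f\<close> nonnegative, and monotonicity is accordingly claimed
    only from points other than 0.\<close>
  define f where "f x = (if x = 0 then 0 else 1 / F \<bar>x\<bar> - 1)" for x
  have hlim': "(\<lambda>k. h (s k)) \<longlonglongrightarrow> 0" using LIMSEQ_subseq_LIMSEQ[OF hlim s] by (simp add: o_def)
  have conv: "(\<lambda>k. b (s k) \<lfloor>x / h (s k)\<rfloor>) \<longlonglongrightarrow> f x" if x: "x \<noteq> 0" "\<bar>x\<bar> \<notin> D" for x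
  proof -
    define y where "y = \<bar>x\<bar>"
    have y: "0 < y" "continuous (at y) F" using x by (auto simp: y_def D_def)
    have ly: "(\<lambda>k. G (s k) y) \<longlonglongrightarrow> F y" by (rule lim[OF y(2)])
    have l1: "(\<lambda>k. b (s k) \<lfloor>y / h (s k)\<rfloor>) \<longlonglongrightarrow> f x"
    proof -
      have "(\<lambda>k. 1 / G (s k) y - 1) \<longlonglongrightarrow> 1 / F y - 1"
        using Fpos[OF y(1)] by (intro tendsto_intros ly) auto
      then show ?thesis using y(1) x(1) by (simp add: step_profile.step_eq_G[OF sp] G_def f_def y_def)
    qed
    \<comment> \<open>Shifting by a vanishing amount is harmless at a continuity point: the shifted
      value is at least the one at \<open>y\<close> and eventually at most the one at a nearby
      continuity point \<open>z > y\<close>, where right-continuity controls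
      \<open>F z\<close>.\<close>
    have "(\<lambda>k. G (s k) (y + 2 * h (s k))) \<longlonglongrightarrow> F y"
    proof (rule order_tendstoI)
      fix c assume "c < F y"
      with ly have "\<forall>\<^sub>F k in sequentially. c < G (s k) y" by (rule order_tendstoD)
      then show "\<forall>\<^sub>F k in sequentially. c < G (s k) (y + 2 * h (s k))"
      proof eventually_elim
        case (elim k)
        have "G (s k) y \<le> G (s k) (y + 2 * h (s k))"
          unfolding G_def using step_profile.h[OF sp, of "s k"]
          by (intro monoD[OF step_profile.G_mono[OF sp]]) simp
        with elim show ?case by simp
      qed
    next
      fix c assume c: "F y < c"
      have "(F \<longlongrightarrow> F y) (at_right y)" using F(1) by (simp add: continuous_within)
      then have "\<forall>\<^sub>F z in at_right y. F z < c" using c by (rule order_tendstoD)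
      then obtain e where e: "y < e" "\<And>z. y < z \<Longrightarrow> z < e \<Longrightarrow> F z < c"
        using eventually_at_right[of y "y + 1"] by auto
      obtain z where z: "y < z" "z < e" "z \<notin> D" using dense[OF e(1)] by auto
      have "(\<lambda>k. G (s k) z) \<longlonglongrightarrow> F z" using lim z(3) by (simp add: D_def)
      then have "\<forall>\<^sub>F k in sequentially. G (s k) z < c" using e(2)[OF z(1,2)] by (rule order_tendstoD)
      moreover have "\<forall>\<^sub>F k in sequentially. h (s k) < (z - y) / 2"
        using hlim' z by (intro order_tendstoD) auto
      ultimately show "\<forall>\<^sub>F k in sequentially. G (s k) (y + 2 * h (s k)) < c"
      proof eventually_elim
        case (elim k)
        have "G (s k) (y + 2 * h (s k)) \<le> G (s k) z"
          unfolding G_def using elim(2)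
          by (intro monoD[OF step_profile.G_mono[OF sp]]) (simp add: field_simps)
        with elim show ?case by simp
      qed
    qed
    then have "(\<lambda>k. 1 / G (s k) (y + 2 * h (s k)) - 1) \<longlonglongrightarrow> 1 / F y - 1"
      using Fpos[OF y(1)] by (intro tendsto_intros) auto
    then have l2: "(\<lambda>k. b (s k) \<lfloor>(y + 2 * h (s k)) / h (s k)\<rfloor>) \<longlonglongrightarrow> f x"
      using y(1) x(1) step_profile.h[OF sp]
      by (subst step_profile.step_eq_G[OF sp]) (auto simp: G_def f_def y_def less_imp_le)
    have "(\<lambda>k. b (s k) \<lfloor>- y / h (s k)\<rfloor>) \<longlonglongrightarrow> f x"
      by (rule tendsto_sandwich[OF _ _ l2 l1])
        (use step_profile.step_reflect[OF sp] y(1) in \<open>auto simp: less_imp_le\<close>)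
    then show ?thesis using l1 by (cases "0 \<le> x") (auto simp: y_def)
  qed
  have [measurable]: "F \<in> borel_measurable borel" by (rule borel_measurable_mono[OF F(2)])
  show thesis
  proof
    show "strict_mono s" by fact
    show "f \<in> borel_measurable borel" unfolding f_def by measurable
    show "0 \<le> f x" for x using Fpos[of "\<bar>x\<bar>"] F(3)[of "\<bar>x\<bar>"] by (auto simp: f_def)
    show "f (- x) = f x" for x by (simp add: f_def)
    show "f y \<le> f x" if "x \<noteq> 0" "\<bar>x\<bar> \<le> \<bar>y\<bar>" for x y
    proof -
      have "F \<bar>x\<bar> \<le> F \<bar>y\<bar>" using F(2) that by (auto simp: mono_def)
      then show ?thesis using that Fpos[of "\<bar>x\<bar>"] Fpos[of "\<bar>y\<bar>"]
        by (auto simp: f_def intro!: divide_left_mono mult_pos_pos)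
    qed
    have "countable (insert 0 (D \<union> uminus ` D))" using D by auto
    then have "AE x in lborel. x \<notin> insert 0 (D \<union> uminus ` D)"
      by (intro AE_not_in countable_imp_null_set_lborel)
    then show "AE x in lborel. (\<lambda>k. b (s k) \<lfloor>x / h (s k)\<rfloor>) \<longlonglongrightarrow> f x"
    proof eventually_elim
      case (elim x)
      then have "\<bar>x\<bar> \<notin> D" by (cases "0 \<le> x") (auto simp: image_iff)
      with elim show ?case by (intro conv) auto
    qed
  qed
qed

section \<open>Maximizers\<close>

context kernel
begin

lemma N2_sq: "(N2 f)\<^sup>2 = (\<integral>x. (f x)\<^sup>2 \<partial>lborel)" by simp

lemma N1_nonneg: "0 \<le> N1 f" and N2_nonneg: "0 \<le> N2 f" by auto

lemma Q_scale: "Q (\<lambda>x. c * f x) = c\<^sup>2 * Q f"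
proof -
  have "c * f (fst p) * (c * f (snd p)) * w (fst p - snd p) = c\<^sup>2 * (f (fst p) * f (snd p) * w (fst p - snd p))" for p
    by (simp add: power2_eq_square)
  then show ?thesis unfolding Q_def by (simp only: integral_mult_right_zero)
qed

lemma w0_pos: "0 < w 0"
proof -
  obtain r where "0 < w r" by (rule w_pos_near_0)
  then show ?thesis using w_le_0[of r] by linarith
qed

lemma norms_pos:
  assumes "L12 f" "0 < Q f"
  shows "0 < N1 f" "0 < N2 f"
proof -
  have "N1 f \<noteq> 0"
  proof
    assume "N1 f = 0"
    then show False using Q_le_N1[OF assms(1)] assms(2) by simp
  qed
  then show "0 < N1 f" using N1_nonneg[of f] by linarith
  have "N2 f \<noteq> 0"
  proof
    assume "N2 f = 0"
    then show False using Q_le_N2[OF assms(1)] assms(2) by simp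
  qed
  then show "0 < N2 f" using N2_nonneg[of f] by linarith
qed

text \<open>The supremum of the ratios over functions with \<open>Q f > 0\<close>, which have
  positive norms; for the other functions the bound is trivial.\<close>

lemma best_constant:
  obtains C where "0 < C" "\<And>f. L12 f \<Longrightarrow> Q f \<le> C * N1 f * N2 f"
    "\<And>c. c < C \<Longrightarrow> \<exists>f. L12 f \<and> 0 < Q f \<and> c * N1 f * N2 f < Q f"
proof -
  define S where "S = {Q f / (N1 f * N2 f) | f. L12 f \<and> 0 < Q f}"
  obtain f0 where f0: "L12 f0" "0 < Q f0" using ex_Q_pos by auto
  have le: "x \<le> sqrt (w 0)" if x: "x \<in> S" for x
  proof -
    obtain f where f: "L12 f" "0 < Q f" "x = Q f / (N1 f * N2 f)" using x by (auto simp: S_def)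
    then show ?thesis using Q_bound[OF f(1)] norms_pos[OF f(1,2)] by (simp add: pos_divide_le_eq mult.assoc)
  qed
  then have bdd: "bdd_above S" by (auto simp: bdd_above_def)
  have f0S: "Q f0 / (N1 f0 * N2 f0) \<in> S" using f0 by (auto simp: S_def)
  show thesis
  proof (rule that)
    have "0 < Q f0 / (N1 f0 * N2 f0)" using f0 norms_pos[OF f0] by simp
    also have "\<dots> \<le> Sup S" by (rule cSup_upper[OF f0S bdd])
    finally show pos: "0 < Sup S" .
    show "Q f \<le> Sup S * N1 f * N2 f" if f: "L12 f" for f
    proof (cases "0 < Q f")
      case True
      have "Q f / (N1 f * N2 f) \<le> Sup S" by (rule cSup_upper[OF _ bdd]) (use f True in \<open>auto simp: S_def\<close>)
      then show ?thesis using norms_pos[OF f True] by (simp add: pos_divide_le_eq mult.assoc)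
    next
      case False
      moreover have "0 \<le> Sup S * N1 f * N2 f" using pos N1_nonneg[of f] N2_nonneg[of f] by (intro mult_nonneg_nonneg) auto
      ultimately show ?thesis by linarith
    qed
    show "\<exists>f. L12 f \<and> 0 < Q f \<and> c * N1 f * N2 f < Q f" if c: "c < Sup S" for c
    proof -
      obtain x where "x \<in> S" "c < x" using c less_cSup_iff[of S c] bdd f0S by auto
      then obtain f where f: "L12 f" "0 < Q f" "c < Q f / (N1 f * N2 f)" by (auto simp: S_def)
      then show ?thesis using norms_pos[OF f(1,2)] by (auto simp: pos_less_divide_eq mult.assoc)
    qed
  qed
qed

text \<open>The form and the product of the norms are homogeneous of the same degree 2, so the
  profile may be scaled to unit \<open>N2\<close>; a positive factor keeps its order.\<close>

lemma normalized_step: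
  assumes f: "L12 f" and r: "c * N1 f * N2 f < Q f" and c: "0 \<le> c" and \<delta>: "0 < \<delta>"
  shows "\<exists>h b. step_profile b h \<and> h < \<delta> \<and> L12 (\<lambda>x. b \<lfloor>x / h\<rfloor>) \<and> N2 (\<lambda>x. b \<lfloor>x / h\<rfloor>) = 1 \<and>
    0 < Q (\<lambda>x. b \<lfloor>x / h\<rfloor>) \<and> c * N1 (\<lambda>x. b \<lfloor>x / h\<rfloor>) \<le> Q (\<lambda>x. b \<lfloor>x / h\<rfloor>)"
proof (rule rearranged_step[OF f r \<delta>])
  fix h :: real and b :: "int \<Rightarrow> real"
  let ?g = "\<lambda>x. b \<lfloor>x / h\<rfloor>"
  assume h: "0 < h" "h < \<delta>" and b: "\<And>i. 0 \<le> b i" "\<And>i. 0 \<le> i \<Longrightarrow> b (- i) \<le> b i"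
    "\<And>i. 0 \<le> i \<Longrightarrow> b (i + 1) \<le> b (- i)" and g: "L12 ?g" and rg: "c * N1 ?g * N2 ?g < Q ?g"
  define t where "t = inverse (N2 ?g)"
  have "0 \<le> c * N1 ?g * N2 ?g" using c N1_nonneg N2_nonneg by (intro mult_nonneg_nonneg)
  then have Qpos: "0 < Q ?g" using rg by linarith
  note np = norms_pos[OF g Qpos]
  have t: "0 < t" "t * N2 ?g = 1" unfolding t_def using np(2) by (simp_all add: positive_imp_inverse_positive)
  have g': "L12 (\<lambda>x. t * b \<lfloor>x / h\<rfloor>)" using g by (simp add: L12_def power_mult_distrib)
  have n2: "N2 (\<lambda>x. t * b \<lfloor>x / h\<rfloor>) = 1"
    using t by (simp add: power_mult_distrib real_sqrt_mult)
  have n1: "N1 (\<lambda>x. t * b \<lfloor>x / h\<rfloor>) = t * N1 ?g" using t by (simp add: abs_mult)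
  have "c * N1 (\<lambda>x. t * b \<lfloor>x / h\<rfloor>) = t\<^sup>2 * (c * N1 ?g * N2 ?g)"
  proof -
    have "t\<^sup>2 * (c * N1 ?g * N2 ?g) = c * (t * N1 ?g) * (t * N2 ?g)" by (simp only: power2_eq_square mult_ac)
    also have "\<dots> = c * N1 (\<lambda>x. t * b \<lfloor>x / h\<rfloor>)" by (simp only: t(2) n1 mult_1_right)
    finally show ?thesis by (rule sym)
  qed
  also have "\<dots> \<le> t\<^sup>2 * Q ?g" using rg by (intro mult_left_mono) auto
  also have "\<dots> = Q (\<lambda>x. t * b \<lfloor>x / h\<rfloor>)" by (simp add: Q_scale)
  finally have q: "c * N1 (\<lambda>x. t * b \<lfloor>x / h\<rfloor>) \<le> Q (\<lambda>x. t * b \<lfloor>x / h\<rfloor>)" .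
  have "step_profile (\<lambda>i. t * b i) h"
    using h b t by unfold_locales auto
  moreover have "0 < Q (\<lambda>x. t * b \<lfloor>x / h\<rfloor>)" using Qpos t by (simp add: Q_scale)
  ultimately show ?thesis using h g' n2 q
    by (intro exI[of _ h] exI[of _ "\<lambda>i. t * b i"]) simp
qed

text \<open>Dominated convergence under the scale-free bounds
  \<open>\<bar>x\<bar> g x \<le> M\<close> and \<open>\<bar>x\<bar> (g x)\<^sup>2 \<le> 1\<close>: the majorant is not in \<open>L\<^sup>1\<close> or \<open>L\<^sup>2\<close>,
  but it is a sum of a function in \<open>L\<^sup>1\<close> and a bounded function in \<open>L\<^sup>2\<close>.\<close>

lemma Q_limit:
  assumes [measurable]: "\<And>k. g k \<in> borel_measurable borel" "f \<in> borel_measurable borel"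
    and nn: "\<And>k x. 0 \<le> g k x"
    and b1: "\<And>k x. \<bar>x\<bar> * g k x \<le> M" and b2: "\<And>k x. \<bar>x\<bar> * (g k x)\<^sup>2 \<le> 1"
    and lim: "AE x in lborel. (\<lambda>k. g k x) \<longlonglongrightarrow> f x"
  shows "(\<lambda>k. Q (g k)) \<longlonglongrightarrow> Q f"
proof -
  \<comment> \<open>Near 0 the bound \<open>b2\<close> gives
    \<open>g k x <= \<bar>x\<bar> powr (-1/2)\<close>, which is integrable; away from 0 the bound
    \<open>b1\<close> gives \<open>M / \<bar>x\<bar>\<close>, which is square integrable and at most
    \<open>M\<close>.\<close>
  define A where "A x = indicator {-1..1} x * \<bar>x\<bar> powr (-1/2)" for x :: real
  define B where "B x = indicator (- {-1..1}) x * (M / \<bar>x\<bar>)" for x :: real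
  have M: "0 \<le> M" using b1[of 0 0] by simp
  have A: "integrable lborel A" unfolding A_def by (rule integrable_singular_part)
  have "(B x)\<^sup>2 = M\<^sup>2 * (indicator (- {-1..1}) x * \<bar>x\<bar> powr (-2))" for x
    by (auto simp: B_def indicator_def powr_minus divide_inverse power_mult_distrib power_inverse)
  then have B: "integrable lborel (\<lambda>x. (B x)\<^sup>2)"
    using integrable_mult_right[OF integrable_tail_part, of "M\<^sup>2"] by simp
  have A0: "0 \<le> A x" and B0: "0 \<le> B x" and BM: "B x \<le> M" for x
  proof -
    show "B x \<le> M" using M by (auto simp: B_def indicator_def divide_le_eq mult_le_cancel_left1)
  qed (use M in \<open>auto simp: A_def B_def\<close>)
  have gAB: "g k x \<le> A x + B x" if x: "x \<noteq> 0" for k x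
  proof (cases "\<bar>x\<bar> \<le> 1")
    case True
    have "(g k x)\<^sup>2 \<le> 1 / \<bar>x\<bar>" using b2[of x k] x by (simp add: field_simps)
    then have "g k x \<le> sqrt (1 / \<bar>x\<bar>)" by (rule real_le_rsqrt)
    also have "\<dots> = 1 / (\<bar>x\<bar> powr (1 / 2))" by (simp add: powr_half_sqrt real_sqrt_divide)
    also have "\<dots> = \<bar>x\<bar> powr (- (1 / 2))" by (rule powr_minus_divide[symmetric])
    also have "\<dots> = A x" using True by (simp add: A_def abs_le_iff)
    finally show ?thesis using B0[of x] by linarith
  next
    case False
    have "g k x \<le> M / \<bar>x\<bar>" using b1[of x k] x by (simp add: field_simps)
    also have "\<dots> = B x" using False by (auto simp: B_def indicator_def)
    finally show ?thesis using A0[of x] by linarith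
  qed
  \<comment> \<open>Expanding \<open>(A + B)(A + B) w\<close>, the pure \<open>A\<close> term uses
    \<open>w <= w 0\<close>, the mixed terms use \<open>B <= M\<close>, and the pure
    \<open>B\<close> term is split into squares; each part is then integrable on the plane.\<close>
  define D where "D p = w 0 * (A (fst p) * A (snd p)) + M * (A (fst p) * w (fst p - snd p))
     + M * (A (snd p) * w (fst p - snd p))
     + 1/2 * ((B (fst p))\<^sup>2 * w (fst p - snd p)) + 1/2 * ((B (snd p))\<^sup>2 * w (fst p - snd p))" for p
  have D: "integrable (lborel \<Otimes>\<^sub>M lborel) D"
    unfolding D_def
    by (intro Bochner_Integration.integrable_add integrable_mult_right integrable_tensor(1)[OF A A]
        integrable_fst_w(1,2)[OF A] integrable_fst_w(1,2)[OF B])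
  have dom: "g k x * g k y * w (x - y) \<le> D (x, y)" if xy: "x \<noteq> 0" "y \<noteq> 0" for k x y
  proof -
    let ?w = "w (x - y)"
    have "g k x * g k y \<le> (A x + B x) * (A y + B y)"
      using gAB xy nn A0 B0 by (intro mult_mono) (auto intro: add_nonneg_nonneg)
    also have "\<dots> = A x * A y + A x * B y + A y * B x + B x * B y" by (simp add: algebra_simps)
    finally have "g k x * g k y * ?w \<le> (A x * A y + A x * B y + A y * B x + B x * B y) * ?w"
      by (rule mult_right_mono) simp
    also have "\<dots> = A x * A y * ?w + A x * B y * ?w + A y * B x * ?w + B x * B y * ?w"
      by (simp add: algebra_simps)
    also have "\<dots> \<le> A x * A y * w 0 + A x * M * ?w + A y * M * ?w + (((B x)\<^sup>2 + (B y)\<^sup>2) / 2) * ?w"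
    proof (intro add_mono)
      show "A x * A y * ?w \<le> A x * A y * w 0" using A0 by (intro mult_left_mono w_le_0) auto
      show "A x * B y * ?w \<le> A x * M * ?w" "A y * B x * ?w \<le> A y * M * ?w"
        using A0 BM by (intro mult_left_mono mult_right_mono; simp)+
      have "B x * B y \<le> ((B x)\<^sup>2 + (B y)\<^sup>2) / 2" using sum_squares_bound[of "B x" "B y"] by simp
      then show "B x * B y * ?w \<le> (((B x)\<^sup>2 + (B y)\<^sup>2) / 2) * ?w" by (rule mult_right_mono) simp
    qed
    also have "\<dots> = D (x, y)" by (simp add: D_def algebra_simps add_divide_distrib)
    finally show ?thesis .
  qed
  have ne0: "AE p in lborel \<Otimes>\<^sub>M lborel. fst p \<noteq> (0::real) \<and> snd p \<noteq> (0::real)"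
    by (rule AE_lborel_pair[OF AE_lborel_singleton])
  show ?thesis unfolding Q_def
  proof (rule integral_dominated_convergence[OF _ _ D])
    show "AE p in lborel \<Otimes>\<^sub>M lborel. (\<lambda>k. g k (fst p) * g k (snd p) * w (fst p - snd p))
       \<longlonglongrightarrow> f (fst p) * f (snd p) * w (fst p - snd p)"
      using AE_lborel_pair[OF lim] by eventually_elim (auto intro!: tendsto_intros)
    show "AE p in lborel \<Otimes>\<^sub>M lborel. norm (g k (fst p) * g k (snd p) * w (fst p - snd p)) \<le> D p" for k
      using ne0
    proof eventually_elim
      case (elim p)
      then show ?case using dom[of "fst p" "snd p" k] nn by simp
    qed
  qed measurable
qed

lemma maximizer_exists:
  assumes C: "0 < C" "\<And>f. L12 f \<Longrightarrow> Q f \<le> C * N1 f * N2 f"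
    "\<And>c. c < C \<Longrightarrow> \<exists>f. L12 f \<and> 0 < Q f \<and> c * N1 f * N2 f < Q f"
  obtains f where "L12 f" "0 < Q f" "Q f = C * N1 f * N2 f" "\<And>x. 0 \<le> f x"
    "\<And>x. f (- x) = f x" "\<And>x y. x \<noteq> 0 \<Longrightarrow> \<bar>x\<bar> \<le> \<bar>y\<bar> \<Longrightarrow> f y \<le> (f x :: real)"
proof -
  \<comment> \<open>These constants increase to \<open>C\<close>; the summand 2 keeps them at least
    \<open>C / 2\<close> from the start.\<close>
  define c where "c k = C * (1 - 1 / (real k + 2))" for k
  have c: "c k < C" "C / 2 \<le> c k" for k using C(1) by (auto simp: c_def field_simps)
  have clim: "c \<longlonglongrightarrow> C"
  proof -
    have "(\<lambda>k. 1 / (real k + 2)) \<longlonglongrightarrow> 0" by real_asymp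
    from tendsto_mult[OF tendsto_const tendsto_diff[OF tendsto_const this], of C 1] show ?thesis by (simp add: c_def[abs_def])
  qed
  define P where "P k h b \<longleftrightarrow> step_profile b h \<and> h < 1 / (real k + 1) \<and> L12 (\<lambda>x. b \<lfloor>x / h\<rfloor>) \<and> N2 (\<lambda>x. b \<lfloor>x / h\<rfloor>) = 1 \<and>
    0 < Q (\<lambda>x. b \<lfloor>x / h\<rfloor>) \<and> c k * N1 (\<lambda>x. b \<lfloor>x / h\<rfloor>) \<le> Q (\<lambda>x. b \<lfloor>x / h\<rfloor>)" for k h b
  have "\<forall>k. \<exists>h b. P k h b"
  proof
    fix k
    obtain f where "L12 f" "c k * N1 f * N2 f < Q f" using C(3)[OF c(1)] by blast
    then show "\<exists>h b. P k h b" unfolding P_def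
      using c(2)[of k] C(1) by (intro normalized_step) auto
  qed
  then obtain h b where hb: "\<And>k. P k (h k) (b k)" by metis
  then have sp: "\<And>k. step_profile (b k) (h k)" and hk: "\<And>k. h k < 1 / (real k + 1)"
    and g: "\<And>k. L12 (\<lambda>x. b k \<lfloor>x / h k\<rfloor>)" and n2: "\<And>k. N2 (\<lambda>x. b k \<lfloor>x / h k\<rfloor>) = 1"
    and Qpos: "\<And>k. 0 < Q (\<lambda>x. b k \<lfloor>x / h k\<rfloor>)"
    and ratio: "\<And>k. c k * N1 (\<lambda>x. b k \<lfloor>x / h k\<rfloor>) \<le> Q (\<lambda>x. b k \<lfloor>x / h k\<rfloor>)"
    unfolding P_def by blast+
  define u where "u k x = b k \<lfloor>x / h k\<rfloor>" for k x
  note g = g[folded u_def] and n2 = n2[folded u_def] and Qpos = Qpos[folded u_def] and ratio = ratio[folded u_def]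
  have u0: "0 \<le> u k x" for k x using step_profile.b_nonneg[OF sp] by (simp add: u_def)
  have hlim: "h \<longlonglongrightarrow> 0"
  proof (rule tendsto_sandwich[where f = "\<lambda>_. 0" and h = "\<lambda>k. 1 / (real k + 1)"])
    show "(\<lambda>k. 1 / (real k + 1)) \<longlonglongrightarrow> 0" by real_asymp
    show "\<forall>\<^sub>F k in sequentially. 0 \<le> h k" "\<forall>\<^sub>F k in sequentially. h k \<le> 1 / (real k + 1)"
      using hk step_profile.h[OF sp] by (auto intro!: always_eventually less_imp_le)
  qed simp
  \<comment> \<open>With unit \<open>N2\<close>, \<open>C / 2 * N1 <= Q <= 1\<close> yields
    \<open>M\<close>. From \<open>C / 2 * N1 <= Q <= w 0 * N1^2\<close> follows
    \<open>N1 >= C / (2 * w 0)\<close>, and inserting this on the left yields the lower bound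
    \<open>q\<close>.\<close>
  define M where "M = 2 / C"
  define q where "q = C\<^sup>2 / (4 * w 0)"
  have n1M: "N1 (u k) \<le> M" for k
  proof -
    have "C / 2 * N1 (u k) \<le> c k * N1 (u k)" by (intro mult_right_mono c N1_nonneg)
    also have "\<dots> \<le> (N2 (u k))\<^sup>2" using ratio[of k] Q_le_N2[OF g[of k]] by linarith
    finally show ?thesis using n2[of k] C(1) by (simp add: M_def field_simps)
  qed
  have Qlow: "q \<le> Q (u k)" for k
  proof -
    note np = norms_pos(1)[OF g Qpos, of k]
    have 1: "C / 2 * N1 (u k) \<le> Q (u k)" using ratio[of k] mult_right_mono[OF c(2)[of k] N1_nonneg[of "u k"]] by linarith
    also have "\<dots> \<le> w 0 * (N1 (u k))\<^sup>2" by (rule Q_le_N1[OF g])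
    finally have "C / 2 \<le> w 0 * N1 (u k)" using np by (simp add: power2_eq_square)
    then have "C / (2 * w 0) \<le> N1 (u k)" using w0_pos by (simp add: field_simps)
    then have "C / 2 * (C / (2 * w 0)) \<le> C / 2 * N1 (u k)" using C(1) by (intro mult_left_mono) auto
    also have "C / 2 * (C / (2 * w 0)) = q" by (simp add: q_def power2_eq_square)
    finally show ?thesis using 1 by linarith
  qed
  have ui: "integrable lborel (u k)" "integrable lborel (\<lambda>x. (u k x)\<^sup>2)" for k using g[of k] by (auto simp: L12_def)
  have n1u: "(\<integral>x. u k x \<partial>lborel) = N1 (u k)" for k using u0 by simp
  have n2u: "(\<integral>x. (u k x)\<^sup>2 \<partial>lborel) = 1" for k using N2_sq[of "u k"] n2[of k] by simp
  have uneg: "u k x \<le> u k \<bar>x\<bar>" for k x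
    using step_profile.step_reflect(2)[OF sp, of "\<bar>x\<bar>" k] by (cases "0 \<le> x") (auto simp: u_def)
  have uanti: "u k y \<le> u k x" if "0 \<le> x" "x \<le> y" for k x y
    using step_profile.step_anti[OF sp that] by (simp add: u_def)
  have b1: "\<bar>x\<bar> * u k x \<le> M" for k x
  proof (cases "x = 0")
    case True
    then show ?thesis using C(1) by (simp add: M_def)
  next
    case False
    have "\<bar>x\<bar> * u k x \<le> \<bar>x\<bar> * u k \<bar>x\<bar>" by (intro mult_left_mono uneg) simp
    also have "\<dots> \<le> (\<integral>x. u k x \<partial>lborel)"
      by (rule decay_bound[OF ui(1)]) (use False u0 uanti in auto)
    finally show ?thesis using n1M[of k] n1u[of k] by simp
  qed
  have b2: "\<bar>x\<bar> * (u k x)\<^sup>2 \<le> 1" for k x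
  proof (cases "x = 0")
    case False
    have "\<bar>x\<bar> * (u k x)\<^sup>2 \<le> \<bar>x\<bar> * (u k \<bar>x\<bar>)\<^sup>2" by (intro mult_left_mono power_mono uneg u0) simp
    also have "\<dots> \<le> (\<integral>x. (u k x)\<^sup>2 \<partial>lborel)"
      by (rule decay_bound[OF ui(2)]) (use False u0 uanti in \<open>auto intro!: power_mono\<close>)
    finally show ?thesis using n2u[of k] by simp
  qed simp
  \<comment> \<open>A first subsequence makes the \<open>N1\<close> norms converge, so that the
    near-optimality inequalities have a limit; Helly's theorem then selects a second one.\<close>
  have "\<forall>k. N1 (u k) \<in> {0..M}" using n1M by simp
  then obtain \<mu> r where r: "strict_mono (r :: nat \<Rightarrow> nat)" and "((\<lambda>k. N1 (u k)) \<circ> r) \<longlonglongrightarrow> \<mu>"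
    using compact_Icc[of 0 M, unfolded compact_def] by metis
  then have mulim: "(\<lambda>k. N1 (u (r k))) \<longlonglongrightarrow> \<mu>" by (simp add: o_def)
  show thesis
  proof (rule step_profiles_compact[of "\<lambda>k. b (r k)" "\<lambda>k. h (r k)" M])
    show "step_profile (b (r k)) (h (r k))" for k by (rule sp)
    show "(\<lambda>k. h (r k)) \<longlonglongrightarrow> 0" using LIMSEQ_subseq_LIMSEQ[OF hlim r] by (simp add: o_def)
    show "x * b (r k) \<lfloor>x / h (r k)\<rfloor> \<le> M" if "0 < x" for k x
      using b1[of x "r k"] that by (simp add: u_def)
  next
    fix s f
    assume s: "strict_mono (s :: nat \<Rightarrow> nat)" and [measurable]: "f \<in> borel_measurable borel"
      and f0: "\<And>x. 0 \<le> f x" and even: "\<And>x. f (- x) = f x"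
      and anti: "\<And>x y. x \<noteq> 0 \<Longrightarrow> \<bar>x\<bar> \<le> \<bar>y\<bar> \<Longrightarrow> f y \<le> f x"
      and lim: "AE x in lborel. (\<lambda>k. b (r (s k)) \<lfloor>x / h (r (s k))\<rfloor>) \<longlonglongrightarrow> f x"
    define t where "t k = r (s k)" for k
    have t: "strict_mono t" using strict_mono_o[OF r s] by (simp add: t_def[abs_def] o_def)
    have lim': "AE x in lborel. (\<lambda>k. u (t k) x) \<longlonglongrightarrow> f x" using lim by (simp add: u_def t_def)
    have n1lim: "(\<lambda>k. N1 (u (t k))) \<longlonglongrightarrow> \<mu>" using LIMSEQ_subseq_LIMSEQ[OF mulim s] by (simp add: o_def t_def)
    have "(\<lambda>k. \<integral>x. u (t k) x \<partial>lborel) \<longlonglongrightarrow> \<mu>" unfolding n1u by (rule n1lim)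
    note F1 = fatou_real[OF ui(1) \<open>f \<in> borel_measurable borel\<close> u0 f0 lim' this]
    have lim2: "AE x in lborel. (\<lambda>k. (u (t k) x)\<^sup>2) \<longlonglongrightarrow> (f x)\<^sup>2"
      using lim' by eventually_elim (rule tendsto_power)
    have f2: "(\<lambda>x. (f x)\<^sup>2) \<in> borel_measurable borel" by measurable
    have "(\<lambda>k. \<integral>x. (u (t k) x)\<^sup>2 \<partial>lborel) \<longlonglongrightarrow> 1" unfolding n2u by (rule tendsto_const)
    note F2 = fatou_real[OF ui(2) f2 zero_le_power2 zero_le_power2 lim2 this]
    have f: "L12 f" using F1 F2 by (simp add: L12_def)
    have um: "u k \<in> borel_measurable borel" for k using ui(1)[of k] by auto
    have Qlim: "(\<lambda>k. Q (u (t k))) \<longlonglongrightarrow> Q f"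
      by (rule Q_limit[where M = M]) (use um u0 b1 b2 lim' in auto)
    have "C * \<mu> \<le> Q f"
    proof (rule LIMSEQ_le[OF _ Qlim])
      show "(\<lambda>k. c (t k) * N1 (u (t k))) \<longlonglongrightarrow> C * \<mu>"
        using LIMSEQ_subseq_LIMSEQ[OF clim t] n1lim by (intro tendsto_mult) (auto simp: o_def)
    qed (use ratio in auto)
    \<comment> \<open>Fatou may lose mass, but only in the favourable direction: smaller norms with
      the form preserved. Optimality of \<open>C\<close> turns the chain into equalities.\<close>
    moreover have "C * N1 f * N2 f \<le> C * \<mu>"
    proof -
      have n2le: "N2 f \<le> 1" using F2 by simp
      have n1le: "N1 f \<le> \<mu>" using F1 f0 by simp
      have "N1 f * N2 f \<le> \<mu> * 1"
        by (rule mult_mono[OF n1le n2le order_trans[OF N1_nonneg n1le] N2_nonneg])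
      then show ?thesis using C(1) by (simp add: mult.assoc)
    qed
    ultimately have eq: "Q f = C * N1 f * N2 f" using C(2)[OF f] by linarith
    \<comment> \<open>The uniform lower bound excludes the trivial limit 0.\<close>
    have "q \<le> Q f" by (rule LIMSEQ_le_const[OF Qlim]) (use Qlow in auto)
    moreover have "0 < q" using C(1) w0_pos by (simp add: q_def)
    ultimately have "0 < Q f" by linarith
    from that[OF f this eq f0 even anti] show thesis .
  qed
qed

section \<open>Regularity of maximizers by comparison with truncations\<close>

lemma truncation:
  assumes f: "L12 f" and [measurable]: "f1 \<in> borel_measurable borel"
    and f1: "\<And>x. 0 \<le> f1 x" "\<And>x. f1 x \<le> f x"
    and B: "\<And>x. f1 x \<noteq> f x \<Longrightarrow> (\<integral>y. f y * w (x - y) \<partial>lborel) \<le> B"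
  shows "Q f - Q f1 \<le> 2 * B * (N1 f - N1 f1)" "L12 f1"
    "N1 f - N1 f1 = (\<integral>x. f x - f1 x \<partial>lborel)" "N1 f1 \<le> N1 f" "N2 f1 \<le> N2 f"
proof -
  have f0: "0 \<le> f x" for x using f1[of x] by linarith
  show L1: "L12 f1" by (rule L12_dominated[OF f]) (use f1 f0 in auto)
  define g where "g x = f x - f1 x" for x
  have g0: "0 \<le> g x" for x using f1[of x] by (simp add: g_def)
  have i: "integrable lborel f" "integrable lborel f1" "integrable lborel g"
    and i2: "integrable lborel (\<lambda>x. (f x)\<^sup>2)" "integrable lborel (\<lambda>x. (f1 x)\<^sup>2)"
    using f L1 by (auto simp: L12_def g_def[abs_def])
  show d: "N1 f - N1 f1 = (\<integral>x. f x - f1 x \<partial>lborel)" using i f1 f0 by simp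
  have "0 \<le> (\<integral>x. g x \<partial>lborel)" using g0 by simp
  then show "N1 f1 \<le> N1 f" using d by (simp add: g_def)
  show "N2 f1 \<le> N2 f" using i2 f1 f0 by (intro real_sqrt_le_mono integral_mono power_mono) auto
  have m: "g x * (\<integral>y. f y * w (x - y) \<partial>lborel) \<le> g x * B" for x
    using B[of x] g0[of x] by (cases "f1 x = f x") (auto simp: g_def intro: mult_left_mono)
  have ig: "integrable (lborel \<Otimes>\<^sub>M lborel) (\<lambda>p. g (fst p) * f (snd p) * w (fst p - snd p))"
    by (rule integrable_form[OF i(3,1)])
  have ig': "integrable (lborel \<Otimes>\<^sub>M lborel) (\<lambda>p. f (fst p) * g (snd p) * w (fst p - snd p))"
    by (rule integrable_form[OF i(1,3)])
  have swap: "(\<integral>p. f (fst p) * g (snd p) * w (fst p - snd p) \<partial>(lborel \<Otimes>\<^sub>M lborel)) =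
    (\<integral>p. g (fst p) * f (snd p) * w (fst p - snd p) \<partial>(lborel \<Otimes>\<^sub>M lborel))"
  proof -
    have "(\<integral>p. g (fst p) * f (snd p) * w (fst p - snd p) \<partial>(lborel \<Otimes>\<^sub>M lborel)) =
      (\<integral>(x, y). g (fst (y, x)) * f (snd (y, x)) * w (fst (y, x) - snd (y, x)) \<partial>(lborel \<Otimes>\<^sub>M lborel))"
      by (rule lborel_pair.integral_product_swap[symmetric]) (use ig in auto)
    then show ?thesis by (simp add: split_beta' w_swap mult.commute)
  qed
  have "Q f - Q f1 = (\<integral>p. f (fst p) * f (snd p) * w (fst p - snd p) - f1 (fst p) * f1 (snd p) * w (fst p - snd p) \<partial>(lborel \<Otimes>\<^sub>M lborel))"
    unfolding Q_def using integrable_form[OF i(1,1)] integrable_form[OF i(2,2)] by simp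
  also have "\<dots> \<le> (\<integral>p. f (fst p) * g (snd p) * w (fst p - snd p) + g (fst p) * f (snd p) * w (fst p - snd p) \<partial>(lborel \<Otimes>\<^sub>M lborel))"
  proof (rule integral_mono)
    fix p
    \<comment> \<open>With \<open>g = f - f1\<close> the difference of the products is
      \<open>f(x) g(y) + g(x) f1(y)\<close>. Replacing \<open>f1\<close> by \<open>f\<close> makes
      the two terms mirror images, which accounts for the factor 2.\<close>
    have "g (fst p) * f1 (snd p) \<le> g (fst p) * f (snd p)" by (intro mult_left_mono f1 g0)
    then have "f (fst p) * f (snd p) - f1 (fst p) * f1 (snd p) \<le> f (fst p) * g (snd p) + g (fst p) * f (snd p)"
      by (simp add: g_def algebra_simps)
    from mult_right_mono[OF this, of "w (fst p - snd p)"]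
    show "f (fst p) * f (snd p) * w (fst p - snd p) - f1 (fst p) * f1 (snd p) * w (fst p - snd p)
      \<le> f (fst p) * g (snd p) * w (fst p - snd p) + g (fst p) * f (snd p) * w (fst p - snd p)"
      by (simp add: algebra_simps)
  qed (use integrable_form[OF i(1,1)] integrable_form[OF i(2,2)] ig ig' in auto)
  also have "\<dots> = 2 * (\<integral>p. g (fst p) * f (snd p) * w (fst p - snd p) \<partial>(lborel \<Otimes>\<^sub>M lborel))"
    using ig ig' swap by simp
  also have "(\<integral>p. g (fst p) * f (snd p) * w (fst p - snd p) \<partial>(lborel \<Otimes>\<^sub>M lborel)) = (\<integral>x. g x * (\<integral>y. f y * w (x - y) \<partial>lborel) \<partial>lborel)"
    using lborel_pair.integral_fst'[OF ig] by (simp add: mult.assoc)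
  also have "\<dots> \<le> (\<integral>x. g x * B \<partial>lborel)"
    by (rule integral_mono) (use lborel_pair.integrable_fst'[OF ig] i(3) m in \<open>auto simp: mult.assoc\<close>)
  also have "\<dots> = B * (N1 f - N1 f1)" using d by (simp add: g_def mult.commute)
  finally show "Q f - Q f1 \<le> 2 * B * (N1 f - N1 f1)" by simp
qed

lemma maximizer_compact_support:
  assumes C: "0 < C" "\<And>f. L12 f \<Longrightarrow> Q f \<le> C * N1 f * N2 f"
    and f: "L12 f" "0 < Q f" "Q f = C * N1 f * N2 f" "\<And>x. 0 \<le> f x"
    and anti: "\<And>x y. x \<noteq> 0 \<Longrightarrow> \<bar>x\<bar> \<le> \<bar>y\<bar> \<Longrightarrow> f y \<le> (f x :: real)"
  obtains R where "0 < R" "AE x in lborel. R < \<bar>x\<bar> \<longrightarrow> f x = 0"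
proof -
  note [measurable] = L12_measurable[OF f(1)]
  have i: "integrable lborel f" using f(1) by (simp add: L12_def)
  note np = norms_pos[OF f(1,2)]
  have m: "N1 f = (\<integral>x. f x \<partial>lborel)" using f(4) by simp
  \<comment> \<open>Decay gives \<open>B <= 4 * N1 f / R\<close>, so taking \<open>R\<close> above
    \<open>8 * N1 f / (C * N2 f)\<close> makes \<open>2 * B\<close> smaller than
    \<open>C * N2 f\<close>.\<close>
  define R where "R = 8 * N1 f / (C * N2 f) + 1"
  have R: "0 < R" using np C(1) by (auto simp: R_def intro!: add_nonneg_pos divide_nonneg_pos)
  define B where "B = w (R / 2) * N1 f + f (R / 2)"
  have wR: "R / 2 * w (R / 2) \<le> 1"
    unfolding total_w[symmetric] by (rule decay_bound[OF int_w]) (use R in \<open>auto intro: w_anti\<close>)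
  have fR: "R / 2 * f (R / 2) \<le> N1 f"
    unfolding m by (rule decay_bound[OF i]) (use R f(4) anti in auto)
  have "R / 2 * B \<le> 2 * N1 f"
    using mult_right_mono[OF wR N1_nonneg[of f]] fR by (simp add: B_def algebra_simps)
  also have "2 * N1 f < R / 2 * (C * N2 f / 2)"
    using np C(1) by (simp add: R_def field_simps)
  finally have B: "2 * B < C * N2 f" using R by simp
  define f1 where "f1 x = (if \<bar>x\<bar> \<le> R then f x else 0)" for x
  have "(\<integral>y. f y * w (x - y) \<partial>lborel) \<le> B" if "f1 x \<noteq> f x" for x
  proof -
    have x: "R < \<bar>x\<bar>" using that by (auto simp: f1_def split: if_splits)
    have fw: "integrable lborel (\<lambda>y. f y * w (x - y))"
      by (rule Bochner_Integration.integrable_bound[OF integrable_mult_left[OF i, of "w 0"]])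
        (auto simp: abs_mult intro!: mult_left_mono w_le_0)
    have "(\<integral>y. f y * w (x - y) \<partial>lborel) \<le> (\<integral>y. w (R / 2) * f y + f (R / 2) * w (x - y) \<partial>lborel)"
    proof (rule integral_mono[OF fw])
      show "integrable lborel (\<lambda>y. w (R / 2) * f y + f (R / 2) * w (x - y))"
        using i w_shift(1)[of x] by simp
      fix y
      show "f y * w (x - y) \<le> w (R / 2) * f y + f (R / 2) * w (x - y)"
      \<comment> \<open>If \<open>y\<close> is near the origin then \<open>x - y\<close> is at least
        \<open>R / 2\<close> in size and the kernel is small; otherwise \<open>f y\<close> itself is
        small.\<close>
      proof (cases "\<bar>y\<bar> \<le> R / 2")
        case True
        then have "w (x - y) \<le> w (R / 2)" using x R by (intro w_anti) linarith
        then have "f y * w (x - y) \<le> f y * w (R / 2)" using f(4) by (rule mult_left_mono)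
        moreover have "0 \<le> f (R / 2) * w (x - y)" using f(4) by simp
        ultimately show ?thesis by (simp add: mult.commute)
      next
        case False
        then have "f y \<le> f (R / 2)" using R by (intro anti) auto
        then have "f y * w (x - y) \<le> f (R / 2) * w (x - y)" by (rule mult_right_mono) simp
        moreover have "0 \<le> w (R / 2) * f y" using f(4) by simp
        ultimately show ?thesis by linarith
      qed
    qed
    also have "\<dots> = B" using i w_shift[of x] by (simp add: B_def m)
    finally show ?thesis .
  qed
  note fw = this
  have f1: "f1 \<in> borel_measurable borel" unfolding f1_def by measurable
  have f1f: "0 \<le> f1 x" "f1 x \<le> f x" for x using f(4)[of x] by (auto simp: f1_def)
  note T = truncation[OF f(1) f1 f1f fw]
  \<comment> \<open>Only the drop of the \<open>N1\<close> norm is exploited. Optimality makes the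
    loss of the form at least \<open>C * N2 f\<close> times this drop, whereas truncation makes it
    at most \<open>2 * B\<close> times the drop, so the drop is 0.\<close>
  have "Q f1 \<le> C * N1 f1 * N2 f"
    using C(1) by (intro order_trans[OF C(2)[OF T(2)]] mult_left_mono T(5) mult_nonneg_nonneg N1_nonneg) simp_all
  then have "C * N2 f * (N1 f - N1 f1) \<le> 2 * B * (N1 f - N1 f1)"
    using T(1) f(3) by (simp add: algebra_simps)
  then have "N1 f - N1 f1 = 0" using B T(4) by (auto simp: mult_le_cancel_right)
  then have "(\<integral>x. f x - f1 x \<partial>lborel) = 0" using T(3) by simp
  moreover have "integrable lborel (\<lambda>x. f x - f1 x)" using i T(2) by (auto simp: L12_def)
  ultimately have "AE x in lborel. f x - f1 x = 0"
    using integral_nonneg_eq_0_iff_AE[of lborel "\<lambda>x. f x - f1 x"] f(4) by (auto simp: f1_def)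
  then have "AE x in lborel. R < \<bar>x\<bar> \<longrightarrow> f x = 0" by eventually_elim (auto simp: f1_def)
  with R show thesis by (rule that)
qed

text \<open>Cutting at height \<open>K\<close> lowers \<open>N2\<close> by at least a multiple of
  \<open>K\<close> times the drop of \<open>N1\<close>, while optimality bounds the fall of
  \<open>N2\<close> by a multiple of that drop independent of \<open>K\<close>. For large
  \<open>K\<close> the drop must vanish.\<close>

lemma maximizer_bounded:
  assumes C: "0 < C" "\<And>f. L12 f \<Longrightarrow> Q f \<le> C * N1 f * N2 f"
    and f: "L12 f" "0 < Q f" "Q f = C * N1 f * N2 f" "\<And>x. 0 \<le> f x"
  obtains K where "0 < K" "AE x in lborel. f x \<le> K"
proof -
  note [measurable] = L12_measurable[OF f(1)]
  have i: "integrable lborel f" "integrable lborel (\<lambda>x. (f x)\<^sup>2)" using f(1) by (auto simp: L12_def)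
  note np = norms_pos[OF f(1,2)]
  have m: "N1 f = (\<integral>x. f x \<partial>lborel)" using f(4) by simp
  define B where "B = w 0 * N1 f"
  have B: "(\<integral>y. f y * w (x - y) \<partial>lborel) \<le> B" for x
  proof -
    have "(\<integral>y. f y * w (x - y) \<partial>lborel) \<le> (\<integral>y. f y * w 0 \<partial>lborel)"
    proof (rule integral_mono)
      show "integrable lborel (\<lambda>y. f y * w (x - y))"
        by (rule Bochner_Integration.integrable_bound[OF integrable_mult_left[OF i(1), of "w 0"]])
          (auto simp: abs_mult intro!: mult_left_mono w_le_0)
    qed (use i f(4) in \<open>auto intro!: mult_left_mono w_le_0\<close>)
    then show ?thesis by (simp add: B_def m mult.commute)
  qed
  have T: "Q f - Q (\<lambda>x. min (f x) K) \<le> 2 * B * (N1 f - N1 (\<lambda>x. min (f x) K))" "L12 (\<lambda>x. min (f x) K)"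
    "N1 f - N1 (\<lambda>x. min (f x) K) = (\<integral>x. f x - min (f x) K \<partial>lborel)" "N1 (\<lambda>x. min (f x) K) \<le> N1 f"
    "N2 (\<lambda>x. min (f x) K) \<le> N2 f" if K: "0 \<le> K" for K
  proof -
    have 1: "(\<lambda>x. min (f x) K) \<in> borel_measurable borel" by measurable
    have 2: "0 \<le> min (f x) K" "min (f x) K \<le> f x" for x using f(4)[of x] K by auto
    show "Q f - Q (\<lambda>x. min (f x) K) \<le> 2 * B * (N1 f - N1 (\<lambda>x. min (f x) K))" "L12 (\<lambda>x. min (f x) K)"
      "N1 f - N1 (\<lambda>x. min (f x) K) = (\<integral>x. f x - min (f x) K \<partial>lborel)" "N1 (\<lambda>x. min (f x) K) \<le> N1 f"
      "N2 (\<lambda>x. min (f x) K) \<le> N2 f"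
      by (rule truncation[OF f(1) 1 2 B])+
  qed
  \<comment> \<open>A positive lower bound for the \<open>N1\<close> norms of all truncations at
    heights \<open>K >= 1\<close>, fixed before \<open>K\<close> is chosen.\<close>
  define a where "a = N1 (\<lambda>x. min (f x) 1)"
  have "a \<noteq> 0"
  proof
    assume "a = 0"
    then have "AE x in lborel. \<bar>min (f x) 1\<bar> = 0"
      unfolding a_def using T(2)[of 1]
      by (subst (asm) integral_nonneg_eq_0_iff_AE) (auto simp: L12_def)
    then have "AE x in lborel. \<bar>f x\<bar> = 0" by eventually_elim (auto simp: min_def split: if_splits)
    then have "N1 f = 0" by (rule integral_eq_zero_AE)
    then show False using np by simp
  qed
  then have a: "0 < a" using N1_nonneg[of "\<lambda>x. min (f x) 1"] unfolding a_def by linarith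
  define K where "K = 1 + 2 * B * N2 f / (C * a)"
  have B0: "0 \<le> B" using np by (simp add: B_def)
  have K1: "1 \<le> K" using B0 a C(1) np by (simp add: K_def)
  have "2 * B * N2 f < C * a * K" using a C(1) by (simp add: K_def field_simps)
  define f1 where "f1 x = min (f x) K" for x
  note TK = T[of K, folded f1_def]
  have a1: "a \<le> N1 f1" unfolding a_def f1_def
    by (rule integral_mono) (use T(2)[of 1] T(2)[of K] f(4) K1 in \<open>auto simp: L12_def\<close>)
  define \<gamma> where "\<gamma> = N1 f - N1 f1"
  have \<gamma>0: "0 \<le> \<gamma>" using TK(4) K1 by (simp add: \<gamma>_def)
  \<comment> \<open>Where \<open>f\<close> exceeds \<open>K\<close>, the excess of the squares over
    this linear bound is \<open>(f x - K)^2\<close>.\<close>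
  have "2 * K * \<gamma> \<le> (N2 f)\<^sup>2 - (N2 f1)\<^sup>2"
  proof -
    have L1: "L12 f1" using TK(2) K1 by simp
    then have "(N2 f)\<^sup>2 - (N2 f1)\<^sup>2 = (\<integral>x. (f x)\<^sup>2 - (f1 x)\<^sup>2 \<partial>lborel)"
      using i by (simp add: L12_def)
    moreover have "2 * K * \<gamma> = (\<integral>x. 2 * K * (f x - f1 x) \<partial>lborel)"
      using TK(3) K1 by (simp add: \<gamma>_def)
    moreover have "(\<integral>x. 2 * K * (f x - f1 x) \<partial>lborel) \<le> (\<integral>x. (f x)\<^sup>2 - (f1 x)\<^sup>2 \<partial>lborel)"
    proof (rule integral_mono)
      show "2 * K * (f x - f1 x) \<le> (f x)\<^sup>2 - (f1 x)\<^sup>2" for x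
      proof (cases "f x \<le> K")
        case False
        have "(f x)\<^sup>2 - K\<^sup>2 - 2 * K * (f x - K) = (f x - K)\<^sup>2" by (simp add: power2_eq_square algebra_simps)
        also have "0 \<le> (f x - K)\<^sup>2" by simp
        finally show ?thesis using False by (simp add: f1_def)
      qed (simp add: f1_def)
    qed (use i L1 in \<open>auto simp: L12_def\<close>)
    ultimately show ?thesis by linarith
  qed
  also have "\<dots> = (N2 f + N2 f1) * (N2 f - N2 f1)" by (simp add: power2_eq_square algebra_simps)
  also have "\<dots> \<le> (2 * N2 f) * (N2 f - N2 f1)" using TK(5) K1 by (intro mult_right_mono) auto
  finally have n: "K * \<gamma> \<le> N2 f * (N2 f - N2 f1)" by simp
  \<comment> \<open>In contrast to the compact support argument, here the drop of \<open>N1\<close>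
    is discarded and that of \<open>N2\<close> is kept.\<close>
  have "C * N1 f1 * (N2 f - N2 f1) \<le> Q f - Q f1"
  proof -
    have "Q f1 \<le> C * N1 f1 * N2 f1" using TK(2) K1 by (intro C(2)) auto
    moreover have "C * N1 f1 * N2 f \<le> C * N1 f * N2 f"
      using TK(4) K1 C(1) np by (intro mult_right_mono mult_left_mono) auto
    ultimately show ?thesis using f(3) by (simp add: algebra_simps)
  qed
  also have "\<dots> \<le> 2 * B * \<gamma>" using TK(1) K1 by (simp add: \<gamma>_def)
  finally have "C * N1 f1 * (N2 f - N2 f1) \<le> 2 * B * \<gamma>" .
  moreover have "C * a * (N2 f - N2 f1) \<le> C * N1 f1 * (N2 f - N2 f1)"
    using TK(5) K1 C(1) a1 by (intro mult_right_mono mult_left_mono) auto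
  ultimately have "C * a * (N2 f - N2 f1) \<le> 2 * B * \<gamma>" by linarith
  from mult_left_mono[OF this, of "N2 f"] have "C * a * (N2 f * (N2 f - N2 f1)) \<le> 2 * B * N2 f * \<gamma>"
    using np by (simp add: algebra_simps)
  moreover have "C * a * (K * \<gamma>) \<le> C * a * (N2 f * (N2 f - N2 f1))"
    using C(1) a n by (intro mult_left_mono) auto
  ultimately have "(C * a * K) * \<gamma> \<le> (2 * B * N2 f) * \<gamma>" by (simp add: mult.assoc)
  then have "\<gamma> = 0" using \<open>2 * B * N2 f < C * a * K\<close> \<gamma>0 by (auto simp: mult_le_cancel_right)
  then have "(\<integral>x. f x - f1 x \<partial>lborel) = 0" using TK(3) K1 by (simp add: \<gamma>_def)
  moreover have "integrable lborel (\<lambda>x. f x - f1 x)" using i TK(2) K1 by (auto simp: L12_def)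
  ultimately have "AE x in lborel. f x - f1 x = 0"
    using integral_nonneg_eq_0_iff_AE[of lborel "\<lambda>x. f x - f1 x"] by (auto simp: f1_def)
  then have "AE x in lborel. f x \<le> K" by eventually_elim (auto simp: f1_def)
  then show thesis using K1 by (intro that[of K]) auto
qed

lemma best_constant_attained:
  "\<exists>f C. L12 f \<and> 0 < Q f \<and> bounded (range f) \<and> symmetric_decreasing f \<and> compactly_supported f \<and>
     Q f = C * N1 f * N2 f \<and> (\<forall>g. L12 g \<longrightarrow> Q g \<le> C * N1 g * N2 g)"
proof -
  from best_constant obtain C where C: "0 < C" "\<And>f. L12 f \<Longrightarrow> Q f \<le> C * N1 f * N2 f"
    "\<And>c. c < C \<Longrightarrow> \<exists>f. L12 f \<and> 0 < Q f \<and> c * N1 f * N2 f < Q f"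
    by metis
  show ?thesis
  proof (rule maximizer_exists[OF C])
    fix f :: "real \<Rightarrow> real"
    assume f: "L12 f" "0 < Q f" "Q f = C * N1 f * N2 f" "\<And>x. 0 \<le> f x"
      and even: "\<And>x. f (- x) = f x"
      and anti: "\<And>x y. x \<noteq> 0 \<Longrightarrow> \<bar>x\<bar> \<le> \<bar>y\<bar> \<Longrightarrow> f y \<le> f x"
    obtain R where R: "0 < R" "AE x in lborel. R < \<bar>x\<bar> \<longrightarrow> f x = 0"
      by (rule maximizer_compact_support[OF C(1,2) f anti])
    obtain K where K: "0 < K" "AE x in lborel. f x \<le> K"
      by (rule maximizer_bounded[OF C(1,2) f])
    note [measurable] = L12_measurable[OF f(1)]
    \<comment> \<open>A representative of \<open>f\<close>, changed only on a null set. The value at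
      0 has to be reset because monotonicity of \<open>f\<close> is known only away from 0;
      \<open>K\<close> dominates all other values.\<close>
    define g where "g x = (if \<bar>x\<bar> \<le> R then if x = 0 then K else min (f x) K else 0)" for x
    have [measurable]: "g \<in> borel_measurable borel" unfolding g_def by measurable
    have ae: "AE x in lborel. g x = f x"
      using R(2) K(2) AE_lborel_singleton[of 0] by eventually_elim (auto simp: g_def)
    have Q: "Q g = Q f" by (rule Q_cong[OF ae]) measurable
    have n1: "N1 g = N1 f" by (rule integral_cong_AE) (use ae in \<open>auto elim!: eventually_mono\<close>)
    have "(\<integral>x. (g x)\<^sup>2 \<partial>lborel) = (\<integral>x. (f x)\<^sup>2 \<partial>lborel)"
      by (rule integral_cong_AE) (use ae in \<open>auto elim!: eventually_mono\<close>)
    then have n2: "N2 g = N2 f" by simp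
    have "L12 g"
    proof -
      have "integrable lborel g \<longleftrightarrow> integrable lborel f"
        by (rule integrable_cong_AE) (use ae in auto)
      moreover have "integrable lborel (\<lambda>x. (g x)\<^sup>2) \<longleftrightarrow> integrable lborel (\<lambda>x. (f x)\<^sup>2)"
        by (rule integrable_cong_AE) (use ae in \<open>auto elim!: eventually_mono\<close>)
      ultimately show ?thesis using f(1) by (simp add: L12_def)
    qed
    moreover have g0: "0 \<le> g x" "g x \<le> K" for x using K(1) f(4)[of x] by (auto simp: g_def)
    then have "bounded (range g)" by (auto simp: bounded_iff intro!: exI[of _ K])
    moreover have "symmetric_decreasing g"
      unfolding symmetric_decreasing_def
    proof (intro conjI allI impI)
      show "g (- x) = g x" for x by (simp add: g_def even)
      show "g y \<le> g x" if "\<bar>x\<bar> \<le> \<bar>y\<bar>" for x y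
      proof (cases "x = 0")
        case True
        then show ?thesis using g0 R(1) by (simp add: g_def[of 0])
      next
        case False
        then have "f y \<le> f x" "y \<noteq> 0" using anti that by auto
        then show ?thesis using False that f(4)[of x] K(1) by (auto simp: g_def)
      qed
    qed (rule g0)
    moreover have "compactly_supported g"
    proof -
      have "{x. g x \<noteq> 0} \<subseteq> {-R..R}" by (auto simp: g_def split: if_splits)
      then have "bounded {x. g x \<noteq> 0}" by (rule bounded_subset[rotated]) simp
      then show ?thesis unfolding compactly_supported_def by (simp add: compact_closure)
    qed
    ultimately show ?thesis using f Q n1 n2 C(2) by (intro exI[of _ g] exI[of _ C]) auto
  qed
qed

end

section \<open>Return to Lebesgue measurable functions\<close>

lemma borel_version:
  assumes "in_Lp 1 f" "in_Lp 2 f"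
  obtains g where "g \<in> borel_measurable borel" "AE x in lborel. f x = g x" "L12 g"
    "Lp_norm 1 f = N1 g" "Lp_norm 2 f = N2 g"
proof -
  have fm: "f \<in> borel_measurable lebesgue" using assms by (simp add: in_Lp_def)
  obtain g where gm: "g \<in> borel_measurable lborel" and ae: "AE x in lborel. f x = g x"
    using completion_ex_borel_measurable_real[OF fm] by auto
  then have g[measurable]: "g \<in> borel_measurable borel" by simp
  have gl: "g \<in> borel_measurable lebesgue" using gm by (rule measurable_completion)
  have ae': "AE x in lebesgue. f x = g x" using ae by (rule AE_completion)
  have aep: "AE x in lebesgue. \<bar>f x\<bar> powr p = \<bar>g x\<bar> powr p" for p using ae' by eventually_elim simp
  have "in_Lp p f \<longleftrightarrow> in_Lp p g" for p
    using fm gl integrable_cong_AE[OF _ _ aep[of p]] unfolding in_Lp_def by auto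
  then have "L12 g" using assms in_Lp_L12[OF g] by blast
  moreover have "Lp_norm p f = Lp_norm p g" for p
  proof -
    have "(\<integral>x. \<bar>f x\<bar> powr p \<partial>lebesgue) = (\<integral>x. \<bar>g x\<bar> powr p \<partial>lebesgue)"
      by (rule integral_cong_AE) (use fm gl aep in auto)
    then show ?thesis by (simp add: Lp_norm_def)
  qed
  ultimately show thesis using that[OF g ae] Lp_norm_lborel[OF g] by simp
qed

text \<open>Up to sign, \<open>w\<close> is a monotone function composed with the absolute value;
  freezing the argument at 0 on the negative axis makes \<open>u\<close> monotone on the whole
  line.\<close>

lemma symmetric_decreasing_borel:
  assumes "symmetric_decreasing w"
  shows "w \<in> borel_measurable borel"
proof -
  define u where "u x = - w (max 0 x)" for x
  have "mono u" using assms by (auto simp: mono_def u_def symmetric_decreasing_def)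
  then have [measurable]: "u \<in> borel_measurable borel" by (rule borel_measurable_mono)
  have "w x = - u \<bar>x\<bar>" for x
    using assms by (cases "0 \<le> x") (auto simp: u_def symmetric_decreasing_def)
  then have "w = (\<lambda>x. - u \<bar>x\<bar>)" by auto
  also have "\<dots> \<in> borel_measurable borel" by measurable
  finally show ?thesis .
qed

theorem theorem1:
  fixes w :: "real \<Rightarrow> real"
  assumes "symmetric_decreasing w"
    and "in_Lp 1 w" and "in_Linf w"
    and "Lp_norm 1 w = 1" and "Linf_norm w = 1"
  shows "\<exists>f :: real \<Rightarrow> real.
           in_Lp 1 f \<and> in_Lp 2 f \<and>
           \<not> (AE x in lebesgue. f x = 0) \<and>
           bounded (range f) \<and> symmetric_decreasing f \<and> compactly_supported f \<and>
           conv_form w f = C_opt w * Lp_norm 1 f * Lp_norm 2 f"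
proof -
  have wb: "w \<in> borel_measurable borel" by (rule symmetric_decreasing_borel) fact
  have "\<bar>w x\<bar> = w x" for x using assms(1) by (simp add: symmetric_decreasing_def)
  then have "N1 w = (\<integral>x. w x \<partial>lborel)" by simp
  then interpret kernel w
    using assms(1,2,4) wb Lp_norm_lborel(1)[OF wb] by unfold_locales (auto simp: in_Lp_1 integrable_completion)
  obtain f C where f: "L12 f" "0 < Q f" "bounded (range f)" "symmetric_decreasing f" "compactly_supported f"
    and eq: "Q f = C * N1 f * N2 f" and C: "\<And>g. L12 g \<Longrightarrow> Q g \<le> C * N1 g * N2 g"
    using best_constant_attained by blast
  have fb: "f \<in> borel_measurable borel" by (rule L12_measurable[OF f(1)])
  have Lf: "in_Lp 1 f" "in_Lp 2 f" using in_Lp_L12[OF fb] f(1) by auto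
  have cf: "conv_form w f = Q f"
    by (rule conv_form_cong) (use fb in \<open>auto intro: measurable_completion\<close>)
  have eq': "conv_form w f = C * Lp_norm 1 f * Lp_norm 2 f"
    using eq cf Lp_norm_lborel[OF fb] by simp
  note np = norms_pos[OF f(1,2)]
  \<comment> \<open>The least constant exists because \<open>C\<close> is attained: any admissible
    \<open>D\<close>, tested on \<open>f\<close>, is at least \<open>C\<close> after division by the
    positive norms of \<open>f\<close>.\<close>
  have "C_opt w = C"
    unfolding C_opt_def
  proof (rule Least_equality)
    show "\<forall>g. in_Lp 1 g \<and> in_Lp 2 g \<longrightarrow> conv_form w g \<le> C * Lp_norm 1 g * Lp_norm 2 g"
    proof (intro allI impI, elim conjE)
      fix g assume g: "in_Lp 1 g" "in_Lp 2 g"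
      obtain g' where g': "g' \<in> borel_measurable borel" "AE x in lborel. g x = g' x" "L12 g'"
        "Lp_norm 1 g = N1 g'" "Lp_norm 2 g = N2 g'"
        by (rule borel_version[OF g])
      have "conv_form w g = Q g'"
        by (rule conv_form_cong[OF g'(2,1)]) (use g in \<open>simp add: in_Lp_def\<close>)
      then show "conv_form w g \<le> C * Lp_norm 1 g * Lp_norm 2 g" using C[OF g'(3)] g'(4,5) by simp
    qed
  next
    fix D assume "\<forall>g. in_Lp 1 g \<and> in_Lp 2 g \<longrightarrow> conv_form w g \<le> D * Lp_norm 1 g * Lp_norm 2 g"
    then have "C * N1 f * N2 f \<le> D * N1 f * N2 f"
      using Lf eq' Lp_norm_lborel[OF fb] by metis
    then show "C \<le> D" using np by (simp add: mult.assoc)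
  qed
  moreover have "\<not> (AE x in lebesgue. f x = 0)"
  proof
    assume "AE x in lebesgue. f x = 0"
    then have "AE x in lborel. \<bar>f x\<bar> = 0" by (simp add: AE_completion_iff)
    then have "N1 f = 0" by (rule integral_eq_zero_AE)
    then show False using np by simp
  qed
  ultimately show ?thesis using Lf f(3-5) eq' by (intro exI[of _ f]) simp
qed

end
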